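(* Let $0<r<1$ and let $(T_1,\dots,T_d)$ be a doubly commuting tuple of operators in $C_{1,r}$ acting on a Hilbert space $\mathcal H$. If $\sigma((T_j^*T_j)^{1/2})$ is a finite subset of $(r,1)$ for $1\le j\le d$, then there exist a Hilbert space $\mathcal K$, an isometry $V:\mathcal H\to\mathcal K$ and a doubly commuting tuple $(M_1,\dots,M_d)$ of operators in $\mathcal C_{1,r}$ acting on $\mathcal K$ such that $T_1^{n_1}\cdots T_d^{n_d}=V^*M_1^{n_1}\cdots M_d^{n_d}V$ for all integers $n_1,\dots,n_d$.
   Context: $C_{1,r}=\{T: T\text{ invertible},\ \|T\|\le1,\ \|rT^{-1}\|\le1\}$. $\mathcal C_{1,r}$ is the class of operators $M$ on a Hilbert space $\mathcal K$ for which there exist orthogonal projections $P_0,P_1$ on $\mathcal K$ with $P_0+P_1=I_{\mathcal K}$ and $M^*M=P_0+r^2P_1$. A tuple is doubly commuting if $T_iT_j=T_jT_i$ for all $i,j$ and $T_iT_j^*=T_j^*T_i$ for $i\ne j$. Negative powers $M_j^{n}$, $n<0$, refer to inverses (the $M_j$ being invertible). *)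

theory Defs
  imports Complex_Main
begin

text \<open>HOL-Analysis has no complex Hilbert spaces / bounded operators with adjoints.
  We therefore model a complex Hilbert space explicitly as a structure on a carrier
  set (this also allows existential quantification over the dilation space K).\<close>

record 'a chs =
  carrier :: "'a set"
  vzero   :: 'a
  vadd    :: "'a \<Rightarrow> 'a \<Rightarrow> 'a"
  vscale  :: "complex \<Rightarrow> 'a \<Rightarrow> 'a"
  cinner  :: "'a \<Rightarrow> 'a \<Rightarrow> complex"

definition vsub :: "'a chs \<Rightarrow> 'a \<Rightarrow> 'a \<Rightarrow> 'a" where
  "vsub H x y = vadd H x (vscale H (-1) y)"

definition hnorm :: "'a chs \<Rightarrow> 'a \<Rightarrow> real" where
  "hnorm H x = sqrt (Re (cinner H x x))"

definition hilbert_space :: "'a chs \<Rightarrow> bool" where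
  "hilbert_space H \<longleftrightarrow>
     vzero H \<in> carrier H \<and>
     (\<forall>x\<in>carrier H. \<forall>y\<in>carrier H. vadd H x y \<in> carrier H) \<and>
     (\<forall>a. \<forall>x\<in>carrier H. vscale H a x \<in> carrier H) \<and>
     (\<forall>x\<in>carrier H. \<forall>y\<in>carrier H. \<forall>z\<in>carrier H.
         vadd H (vadd H x y) z = vadd H x (vadd H y z)) \<and>
     (\<forall>x\<in>carrier H. \<forall>y\<in>carrier H. vadd H x y = vadd H y x) \<and>
     (\<forall>x\<in>carrier H. vadd H (vzero H) x = x) \<and>
     (\<forall>x\<in>carrier H. \<exists>y\<in>carrier H. vadd H x y = vzero H) \<and>
     (\<forall>a. \<forall>x\<in>carrier H. \<forall>y\<in>carrier H.
         vscale H a (vadd H x y) = vadd H (vscale H a x) (vscale H a y)) \<and>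
     (\<forall>a b. \<forall>x\<in>carrier H. vscale H (a + b) x = vadd H (vscale H a x) (vscale H b x)) \<and>
     (\<forall>a b. \<forall>x\<in>carrier H. vscale H (a * b) x = vscale H a (vscale H b x)) \<and>
     (\<forall>x\<in>carrier H. vscale H 1 x = x) \<and>
     (\<forall>x\<in>carrier H. \<forall>y\<in>carrier H. cinner H x y = cnj (cinner H y x)) \<and>
     (\<forall>x\<in>carrier H. \<forall>y\<in>carrier H. \<forall>z\<in>carrier H.
         cinner H (vadd H x y) z = cinner H x z + cinner H y z) \<and>
     (\<forall>a. \<forall>x\<in>carrier H. \<forall>y\<in>carrier H. cinner H (vscale H a x) y = a * cinner H x y) \<and>
     (\<forall>x\<in>carrier H. 0 \<le> Re (cinner H x x)) \<and>
     (\<forall>x\<in>carrier H. cinner H x x = 0 \<longrightarrow> x = vzero H) \<and>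
     (\<forall>s::nat \<Rightarrow> 'a. (\<forall>n. s n \<in> carrier H) \<longrightarrow>
        (\<forall>e>0. \<exists>N. \<forall>m\<ge>N. \<forall>n\<ge>N. hnorm H (vsub H (s m) (s n)) < e) \<longrightarrow>
        (\<exists>l\<in>carrier H. \<forall>e>0. \<exists>N. \<forall>n\<ge>N. hnorm H (vsub H (s n) l) < e))"

definition bounded_op :: "'a chs \<Rightarrow> 'b chs \<Rightarrow> ('a \<Rightarrow> 'b) \<Rightarrow> bool" where
  "bounded_op H K T \<longleftrightarrow>
     (\<forall>x\<in>carrier H. T x \<in> carrier K) \<and>
     (\<forall>x\<in>carrier H. \<forall>y\<in>carrier H. T (vadd H x y) = vadd K (T x) (T y)) \<and>
     (\<forall>a. \<forall>x\<in>carrier H. T (vscale H a x) = vscale K a (T x)) \<and>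
     (\<exists>C. \<forall>x\<in>carrier H. hnorm K (T x) \<le> C * hnorm H x)"

definition is_adjoint :: "'a chs \<Rightarrow> 'b chs \<Rightarrow> ('a \<Rightarrow> 'b) \<Rightarrow> ('b \<Rightarrow> 'a) \<Rightarrow> bool" where
  "is_adjoint H K T S \<longleftrightarrow> bounded_op H K T \<and> bounded_op K H S \<and>
     (\<forall>x\<in>carrier H. \<forall>y\<in>carrier K. cinner K (T x) y = cinner H x (S y))"

text \<open>The Hilbert space adjoint \<open>T\<^sup>*\<close> (unique on the carrier).\<close>
definition adj :: "'a chs \<Rightarrow> 'b chs \<Rightarrow> ('a \<Rightarrow> 'b) \<Rightarrow> ('b \<Rightarrow> 'a)" where
  "adj H K T = (SOME S. is_adjoint H K T S)"

definition invertible_op :: "'a chs \<Rightarrow> ('a \<Rightarrow> 'a) \<Rightarrow> bool" where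
  "invertible_op H T \<longleftrightarrow> bounded_op H H T \<and>
     (\<exists>S. bounded_op H H S \<and> (\<forall>x\<in>carrier H. S (T x) = x \<and> T (S x) = x))"

definition inv_op :: "'a chs \<Rightarrow> ('a \<Rightarrow> 'a) \<Rightarrow> ('a \<Rightarrow> 'a)" where
  "inv_op H T = (SOME S. bounded_op H H S \<and> (\<forall>x\<in>carrier H. S (T x) = x \<and> T (S x) = x))"

definition opnorm_le :: "'a chs \<Rightarrow> ('a \<Rightarrow> 'a) \<Rightarrow> real \<Rightarrow> bool" where
  "opnorm_le H T c \<longleftrightarrow> (\<forall>x\<in>carrier H. hnorm H (T x) \<le> c * hnorm H x)"

definition class_C1r :: "real \<Rightarrow> 'a chs \<Rightarrow> ('a \<Rightarrow> 'a) \<Rightarrow> bool" where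
  "class_C1r r H T \<longleftrightarrow> invertible_op H T \<and> opnorm_le H T 1 \<and>
     opnorm_le H (\<lambda>x. vscale H (complex_of_real r) (inv_op H T x)) 1"

definition orth_proj :: "'a chs \<Rightarrow> ('a \<Rightarrow> 'a) \<Rightarrow> bool" where
  "orth_proj H P \<longleftrightarrow> bounded_op H H P \<and> (\<forall>x\<in>carrier H. P (P x) = P x) \<and>
     (\<forall>x\<in>carrier H. \<forall>y\<in>carrier H. cinner H (P x) y = cinner H x (P y))"

definition class_calC1r :: "real \<Rightarrow> 'a chs \<Rightarrow> ('a \<Rightarrow> 'a) \<Rightarrow> bool" where
  "class_calC1r r K M \<longleftrightarrow> bounded_op K K M \<and>
     (\<exists>P0 P1. orth_proj K P0 \<and> orth_proj K P1 \<and>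
        (\<forall>x\<in>carrier K. vadd K (P0 x) (P1 x) = x) \<and>
        (\<forall>x\<in>carrier K. adj K K M (M x) =
            vadd K (P0 x) (vscale K (complex_of_real (r\<^sup>2)) (P1 x))))"

definition doubly_commuting :: "'a chs \<Rightarrow> nat \<Rightarrow> (nat \<Rightarrow> 'a \<Rightarrow> 'a) \<Rightarrow> bool" where
  "doubly_commuting H d T \<longleftrightarrow>
     (\<forall>i<d. \<forall>j<d. \<forall>x\<in>carrier H. T i (T j x) = T j (T i x)) \<and>
     (\<forall>i<d. \<forall>j<d. i \<noteq> j \<longrightarrow>
        (\<forall>x\<in>carrier H. T i (adj H H (T j) x) = adj H H (T j) (T i x)))"

definition positive_op :: "'a chs \<Rightarrow> ('a \<Rightarrow> 'a) \<Rightarrow> bool" where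
  "positive_op H B \<longleftrightarrow> bounded_op H H B \<and>
     (\<forall>x\<in>carrier H. Im (cinner H (B x) x) = 0 \<and> 0 \<le> Re (cinner H (B x) x))"

text \<open>Positive square root \<open>A\<^sup>1\<^sup>/\<^sup>2\<close> of a positive operator (unique on the carrier).\<close>
definition op_sqrt :: "'a chs \<Rightarrow> ('a \<Rightarrow> 'a) \<Rightarrow> ('a \<Rightarrow> 'a)" where
  "op_sqrt H A = (SOME B. positive_op H B \<and> (\<forall>x\<in>carrier H. B (B x) = A x))"

definition op_spectrum :: "'a chs \<Rightarrow> ('a \<Rightarrow> 'a) \<Rightarrow> complex set" where
  "op_spectrum H A = {z. \<not> invertible_op H (\<lambda>x. vadd H (A x) (vscale H (- z) x))}"

definition zpow :: "'a chs \<Rightarrow> ('a \<Rightarrow> 'a) \<Rightarrow> int \<Rightarrow> ('a \<Rightarrow> 'a)" where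
  "zpow H T n = (if 0 \<le> n then T ^^ nat n else inv_op H T ^^ nat (- n))"

text \<open>\<open>T\<^sub>0\<^sup>n\<^sup>0 \<circ> T\<^sub>1\<^sup>n\<^sup>1 \<circ> \<dots> \<circ> T\<^sub>d\<^sub>-\<^sub>1\<^sup>n\<^sup>d\<^sup>-\<^sup>1\<close> (indices shifted to 0-based).\<close>
definition multi_pow :: "'a chs \<Rightarrow> nat \<Rightarrow> (nat \<Rightarrow> 'a \<Rightarrow> 'a) \<Rightarrow> (nat \<Rightarrow> int) \<Rightarrow> ('a \<Rightarrow> 'a)" where
  "multi_pow H d T n = foldr (\<lambda>j acc. zpow H (T j) (n j) \<circ> acc) [0..<d] id"

definition isometry_op :: "'a chs \<Rightarrow> 'b chs \<Rightarrow> ('a \<Rightarrow> 'b) \<Rightarrow> bool" where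
  "isometry_op H K V \<longleftrightarrow> bounded_op H K V \<and> (\<forall>x\<in>carrier H. hnorm K (V x) = hnorm H x)"

end

theory Submission
  imports Defs
begin

text \<open>
  Let \<open>B = T\<^sup>*T\<close>, so \<open>r\<^sup>2 \<le> B \<le> 1\<close>, and write \<open>B = C\<^sup>2 + r\<^sup>2 G\<^sup>2\<close> with commuting positive
  \<open>C\<close>, \<open>G\<close> such that \<open>C\<^sup>2 + G\<^sup>2 = 1\<close>.  On \<open>H \<oplus> H\<close> put \<open>Rot = [[C, G], [G, -C]]\<close>, \<open>Q = [[C, r G], [r G, -C]]\<close> and
  \<open>D = diag(1, r)\<close>; then \<open>Rot\<^sup>2 = 1\<close> and \<open>Q\<^sup>2 = B \<oplus> B\<close>.  The operator
  \<open>M = Rot (T\<^sup>*)\<^sup>-\<^sup>1 Q D\<close> satisfies \<open>M\<^sup>*M = D\<^sup>2\<close>, and the isometry \<open>V x = (C x, G x)\<close>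
  satisfies \<open>M V = V T\<close>.  Everything commuting with \<open>T\<close> and \<open>T\<^sup>*\<close>, doubled, is intertwined by \<open>V\<close> and commutes with
  \<open>M\<close> and \<open>M\<^sup>*\<close>, so the tuple can be treated one operator at a time.  An infinite carrier is
  equinumerous with its square, so every intermediate space can be realised on the original type.
\<close>

section \<open>Hilbert spaces\<close>

text \<open>The intertwining \<open>M V = V T\<close> says more than the compression
  \<open>T = V* M V\<close>: it composes along successive dilations and passes to inverses, so every
  mixed integer power follows from V* V = 1. It also explains the factors of \<open>M\<close>. One
  has Q D V x = (B x, 0), the inverse of T* turns B x into T x, and \<open>Rot\<close> sends (T x,
  0) to V T x. Writing T as the inverse of T* applied to B replaces a polar decomposition, and each
  entry of \<open>M\<close> commutes with whatever commutes with T and T*. M* M = D^2 holds because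
  the entries of Q commute with B^-1, whence Q B^-1 Q = 1. The two conditions on C and G are linear
  in their squares, so C^2 and G^2 are affine in B, and the only functional calculus required is the
  square root of a positive contraction. Two features of the setting shape the rest. Adjoints and
  inverses are choices that are determined only on carriers, so the intermediate properties are
  stated through inner products and norms. And an induction cannot change the type of the space,
  although each dilation doubles it.\<close>

lemma null_bound:
  fixes f :: "nat \<Rightarrow> 'b::real_normed_vector"
  assumes "\<And>n. norm (f n) \<le> b n" and "b \<longlonglongrightarrow> 0"
  shows "f \<longlonglongrightarrow> 0"
  using assms(1) order_trans[OF assms(1) abs_ge_self] by (intro tendsto_0_le[OF assms(2), of f 1]) simp

locale hilbert =
  fixes H :: "'a chs"
  assumes hilbert_space: "hilbert_space H"
begin

abbreviation add (infixl "\<oplus>" 65) where "x \<oplus> y \<equiv> vadd H x y"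
abbreviation scale (infixr "\<odot>" 75) where "a \<odot> x \<equiv> vscale H a x"
abbreviation inner ("\<langle>_, _\<rangle>") where "\<langle>x, y\<rangle> \<equiv> cinner H x y"
abbreviation nrm ("\<parallel>_\<parallel>") where "\<parallel>x\<parallel> \<equiv> hnorm H x"
abbreviation X where "X \<equiv> carrier H"

lemma hilbert_axioms:
  shows "vzero H \<in> X"
    and "\<forall>x\<in>X. \<forall>y\<in>X. x \<oplus> y \<in> X"
    and "\<forall>a. \<forall>x\<in>X. a \<odot> x \<in> X"
    and "\<forall>x\<in>X. \<forall>y\<in>X. \<forall>z\<in>X. (x \<oplus> y) \<oplus> z = x \<oplus> (y \<oplus> z)"
    and "\<forall>x\<in>X. \<forall>y\<in>X. x \<oplus> y = y \<oplus> x"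
    and "\<forall>x\<in>X. vzero H \<oplus> x = x"
    and "\<forall>a b. \<forall>x\<in>X. (a + b) \<odot> x = a \<odot> x \<oplus> b \<odot> x"
    and "\<forall>x\<in>X. 1 \<odot> x = x"
    and "\<forall>x\<in>X. \<forall>y\<in>X. \<langle>x, y\<rangle> = cnj \<langle>y, x\<rangle>"
    and "\<forall>x\<in>X. \<forall>y\<in>X. \<forall>z\<in>X. \<langle>x \<oplus> y, z\<rangle> = \<langle>x, z\<rangle> + \<langle>y, z\<rangle>"
    and "\<forall>a. \<forall>x\<in>X. \<forall>y\<in>X. \<langle>a \<odot> x, y\<rangle> = a * \<langle>x, y\<rangle>"
    and "\<forall>x\<in>X. 0 \<le> Re \<langle>x, x\<rangle>"
    and "\<forall>x\<in>X. \<langle>x, x\<rangle> = 0 \<longrightarrow> x = vzero H"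
    and "\<forall>s::nat \<Rightarrow> 'a. (\<forall>n. s n \<in> X) \<longrightarrow>
      (\<forall>e>0. \<exists>N. \<forall>m\<ge>N. \<forall>n\<ge>N. \<parallel>vsub H (s m) (s n)\<parallel> < e) \<longrightarrow>
      (\<exists>l\<in>X. \<forall>e>0. \<exists>N. \<forall>n\<ge>N. \<parallel>vsub H (s n) l\<parallel> < e)"
    and "\<forall>x\<in>X. \<exists>y\<in>X. x \<oplus> y = vzero H"
    and "\<forall>a. \<forall>x\<in>X. \<forall>y\<in>X. a \<odot> (x \<oplus> y) = a \<odot> x \<oplus> a \<odot> y"
    and "\<forall>a b. \<forall>x\<in>X. (a * b) \<odot> x = a \<odot> b \<odot> x"
  using hilbert_space unfolding hilbert_space_def by - (elim conjE, assumption)+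

lemma zero_closed [simp]: "vzero H \<in> X"
  by (rule hilbert_axioms)

lemma add_closed [simp]: "\<lbrakk>x \<in> X; y \<in> X\<rbrakk> \<Longrightarrow> x \<oplus> y \<in> X"
  using hilbert_axioms(2) by blast

lemma scale_closed [simp]: "x \<in> X \<Longrightarrow> a \<odot> x \<in> X"
  using hilbert_axioms(3) by blast

lemma add_assoc: "\<lbrakk>x \<in> X; y \<in> X; z \<in> X\<rbrakk> \<Longrightarrow> (x \<oplus> y) \<oplus> z = x \<oplus> (y \<oplus> z)"
  using hilbert_axioms(4) by blast

lemma add_commute: "\<lbrakk>x \<in> X; y \<in> X\<rbrakk> \<Longrightarrow> x \<oplus> y = y \<oplus> x"
  using hilbert_axioms(5) by blast

lemma zero_add [simp]: "x \<in> X \<Longrightarrow> vzero H \<oplus> x = x"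
  using hilbert_axioms(6) by blast

lemma scale_add_left: "x \<in> X \<Longrightarrow> (a + b) \<odot> x = a \<odot> x \<oplus> b \<odot> x"
  using hilbert_axioms(7) by blast

lemma scale_one [simp]: "x \<in> X \<Longrightarrow> 1 \<odot> x = x"
  using hilbert_axioms(8) by blast

lemma ex_neg: "x \<in> X \<Longrightarrow> \<exists>y\<in>X. x \<oplus> y = vzero H"
  using hilbert_axioms(15) by blast

lemma scale_add_right: "\<lbrakk>x \<in> X; y \<in> X\<rbrakk> \<Longrightarrow> a \<odot> (x \<oplus> y) = a \<odot> x \<oplus> a \<odot> y"
  using hilbert_axioms(16) by blast

lemma scale_scale: "x \<in> X \<Longrightarrow> (a * b) \<odot> x = a \<odot> b \<odot> x"
  using hilbert_axioms(17) by blast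

lemma inner_sym: "\<lbrakk>x \<in> X; y \<in> X\<rbrakk> \<Longrightarrow> \<langle>x, y\<rangle> = cnj \<langle>y, x\<rangle>"
  using hilbert_axioms(9) by blast

lemma inner_add_left [simp]: "\<lbrakk>x \<in> X; y \<in> X; z \<in> X\<rbrakk> \<Longrightarrow> \<langle>x \<oplus> y, z\<rangle> = \<langle>x, z\<rangle> + \<langle>y, z\<rangle>"
  using hilbert_axioms(10) by blast

lemma inner_scale_left [simp]: "\<lbrakk>x \<in> X; y \<in> X\<rbrakk> \<Longrightarrow> \<langle>a \<odot> x, y\<rangle> = a * \<langle>x, y\<rangle>"
  using hilbert_axioms(11) by blast

lemma inner_nonneg [simp]: "x \<in> X \<Longrightarrow> 0 \<le> Re \<langle>x, x\<rangle>"
  using hilbert_axioms(12) by blast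

lemma inner_definite: "\<lbrakk>x \<in> X; \<langle>x, x\<rangle> = 0\<rbrakk> \<Longrightarrow> x = vzero H"
  using hilbert_axioms(13) by blast

lemma complete:
  fixes s :: "nat \<Rightarrow> 'a"
  assumes "\<And>n. s n \<in> X"
    and "\<And>e. e > 0 \<Longrightarrow> \<exists>N. \<forall>m\<ge>N. \<forall>n\<ge>N. \<parallel>vsub H (s m) (s n)\<parallel> < e"
  shows "\<exists>l\<in>X. \<forall>e>0. \<exists>N. \<forall>n\<ge>N. \<parallel>vsub H (s n) l\<parallel> < e"
  using hilbert_axioms(14) assms by simp

lemma vsub_closed [simp]: "\<lbrakk>x \<in> X; y \<in> X\<rbrakk> \<Longrightarrow> vsub H x y \<in> X"
  by (simp add: vsub_def)

lemma inner_vsub_left [simp]: "\<lbrakk>x \<in> X; y \<in> X; z \<in> X\<rbrakk> \<Longrightarrow> \<langle>vsub H x y, z\<rangle> = \<langle>x, z\<rangle> - \<langle>y, z\<rangle>"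
  by (simp add: vsub_def)

lemma inner_add_right [simp]: "\<lbrakk>x \<in> X; y \<in> X; z \<in> X\<rbrakk> \<Longrightarrow> \<langle>z, x \<oplus> y\<rangle> = \<langle>z, x\<rangle> + \<langle>z, y\<rangle>"
  by (subst (1 2 3) inner_sym) auto

lemma inner_scale_right [simp]: "\<lbrakk>x \<in> X; y \<in> X\<rbrakk> \<Longrightarrow> \<langle>y, a \<odot> x\<rangle> = cnj a * \<langle>y, x\<rangle>"
  by (subst (1 2) inner_sym) auto

lemma inner_vsub_right [simp]: "\<lbrakk>x \<in> X; y \<in> X; z \<in> X\<rbrakk> \<Longrightarrow> \<langle>z, vsub H x y\<rangle> = \<langle>z, x\<rangle> - \<langle>z, y\<rangle>"
  by (simp add: vsub_def)

lemma inner_zero_left [simp]: "x \<in> X \<Longrightarrow> \<langle>vzero H, x\<rangle> = 0"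
  using inner_add_left[of "vzero H" "vzero H" x] by simp

lemma inner_zero_right [simp]: "x \<in> X \<Longrightarrow> \<langle>x, vzero H\<rangle> = 0"
  by (subst inner_sym) auto

lemma scale_zero_left: "x \<in> X \<Longrightarrow> 0 \<odot> x = vzero H"
  by (rule inner_definite) auto

text \<open>The difference is orthogonal to itself. This is the main device for vector identities:
  testing against an arbitrary \<open>z\<close> turns them into identities of complex numbers, which
  the simplifier settles without any normal form for vectors.\<close>

lemma vec_eqI:
  assumes x: "x \<in> X" and y: "y \<in> X" and eq: "\<And>z. z \<in> X \<Longrightarrow> \<langle>x, z\<rangle> = \<langle>y, z\<rangle>"
  shows "x = y"
proof -
  have z: "x \<oplus> (-1) \<odot> y = vzero H"
    by (rule inner_definite) (use x y eq in simp_all)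
  have m: "(-1) \<odot> y \<oplus> y = vzero H"
    using scale_add_left[OF y, of "-1" 1] y by (simp add: scale_zero_left)
  have "x = x \<oplus> ((-1) \<odot> y \<oplus> y)"
    using x m add_commute[of x "vzero H"] zero_add[OF x] by simp
  also have "\<dots> = (x \<oplus> (-1) \<odot> y) \<oplus> y"
    using x y by (simp add: add_assoc)
  finally show ?thesis
    using y by (simp add: z)
qed

lemma vsub_self [simp]: "x \<in> X \<Longrightarrow> vsub H x x = vzero H"
  by (rule vec_eqI) simp_all

lemma add_zero [simp]: "x \<in> X \<Longrightarrow> x \<oplus> vzero H = x"
  by (rule vec_eqI) simp_all

lemma vsub_zero [simp]: "x \<in> X \<Longrightarrow> vsub H x (vzero H) = x"
  by (rule vec_eqI) simp_all

lemma Im_inner_self [simp]: "x \<in> X \<Longrightarrow> Im \<langle>x, x\<rangle> = 0"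
  using inner_sym[of x x] by (simp add: complex_eq_iff)

lemma nrm_nonneg [simp]: "x \<in> X \<Longrightarrow> 0 \<le> \<parallel>x\<parallel>"
  by (simp add: hnorm_def)

lemma nrm_sq: "x \<in> X \<Longrightarrow> \<parallel>x\<parallel>\<^sup>2 = Re \<langle>x, x\<rangle>"
  by (simp add: hnorm_def)

lemma inner_self: "x \<in> X \<Longrightarrow> \<langle>x, x\<rangle> = complex_of_real (\<parallel>x\<parallel>\<^sup>2)"
  by (simp add: nrm_sq complex_eq_iff)

lemma Re_inner_commute: "\<lbrakk>x \<in> X; y \<in> X\<rbrakk> \<Longrightarrow> Re \<langle>x, y\<rangle> = Re \<langle>y, x\<rangle>"
  by (subst inner_sym) auto

lemma nrm_leI: "\<lbrakk>x \<in> X; 0 \<le> c; Re \<langle>x, x\<rangle> \<le> c\<^sup>2\<rbrakk> \<Longrightarrow> \<parallel>x\<parallel> \<le> c"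
  by (simp add: hnorm_def real_le_lsqrt)

lemma nrm_scale [simp]: 
  assumes "x \<in> X" shows "\<parallel>a \<odot> x\<parallel> = cmod a * \<parallel>x\<parallel>"
proof -
  have "\<langle>a \<odot> x, a \<odot> x\<rangle> = complex_of_real ((cmod a * \<parallel>x\<parallel>)\<^sup>2)"
    using assms complex_norm_square[of a] by (simp add: inner_self[of x] power_mult_distrib)
  hence "\<parallel>a \<odot> x\<parallel>\<^sup>2 = (cmod a * \<parallel>x\<parallel>)\<^sup>2"
    using assms by (simp add: nrm_sq)
  thus ?thesis
    using assms by (simp add: power2_eq_iff_nonneg)
qed

lemma cauchy_schwarz:
  assumes x: "x \<in> X" and y: "y \<in> X"
  shows "cmod \<langle>x, y\<rangle> \<le> \<parallel>x\<parallel> * \<parallel>y\<parallel>"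
proof -
  define c where "c = \<langle>x, y\<rangle>"
  define b where "b = \<parallel>y\<parallel>\<^sup>2"
  \<comment> \<open>\<open>w\<close> is \<open>b\<close> times the component of \<open>x\<close>
    orthogonal to \<open>y\<close>; scaling by b = \<parallel>y\<parallel>^2 avoids a
    division.\<close>
  define w where "w = complex_of_real b \<odot> x \<oplus> (- c) \<odot> y"
  have w: "w \<in> X" using x y by (simp add: w_def)
  have yx: "\<langle>y, x\<rangle> = cnj c" using inner_sym[OF y x] by (simp add: c_def)
  have "\<langle>w, w\<rangle> = complex_of_real (b * (b * \<parallel>x\<parallel>\<^sup>2 - (cmod c)\<^sup>2))"
    using x y complex_norm_square[of c] unfolding w_def
    by (simp add: inner_self[of x] inner_self[of y] yx b_def[symmetric] c_def[symmetric] algebra_simps)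
  hence nn: "0 \<le> b * (b * \<parallel>x\<parallel>\<^sup>2 - (cmod c)\<^sup>2)"
    using inner_nonneg[OF w] by simp
  show ?thesis
  proof (cases "b = 0")
    case True
    hence "y = vzero H" using y by (intro inner_definite) (simp_all add: inner_self b_def)
    thus ?thesis using x by simp
  next
    case False
    hence "b > 0" by (simp add: b_def)
    hence "(cmod c)\<^sup>2 \<le> b * \<parallel>x\<parallel>\<^sup>2"
      using nn by (simp add: zero_le_mult_iff)
    hence "(cmod c)\<^sup>2 \<le> (\<parallel>x\<parallel> * \<parallel>y\<parallel>)\<^sup>2" by (simp add: b_def power_mult_distrib mult.commute)
    thus ?thesis unfolding c_def using x y by (metis mult_nonneg_nonneg nrm_nonneg power2_le_imp_le)
  qed
qed

lemma Re_inner_le: "\<lbrakk>x \<in> X; y \<in> X\<rbrakk> \<Longrightarrow> Re \<langle>x, y\<rangle> \<le> \<parallel>x\<parallel> * \<parallel>y\<parallel>"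
  using cauchy_schwarz complex_Re_le_cmod order_trans by blast

lemma triangle:
  assumes x: "x \<in> X" and y: "y \<in> X"
  shows "\<parallel>x \<oplus> y\<parallel> \<le> \<parallel>x\<parallel> + \<parallel>y\<parallel>"
  using x y Re_inner_le[OF x y] Re_inner_commute[OF x y]
  by (intro nrm_leI) (simp_all add: nrm_sq power2_sum)

lemma nrm_vsub_triangle:
  assumes "x \<in> X" "y \<in> X" "z \<in> X"
  shows "\<parallel>vsub H x z\<parallel> \<le> \<parallel>vsub H x y\<parallel> + \<parallel>vsub H y z\<parallel>"
proof -
  have "vsub H x z = vsub H x y \<oplus> vsub H y z"
    using assms by (intro vec_eqI) simp_all
  thus ?thesis using assms triangle by simp
qed

lemma nrm_vsub_commute:
  assumes "x \<in> X" "y \<in> X"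
  shows "\<parallel>vsub H x y\<parallel> = \<parallel>vsub H y x\<parallel>"
proof -
  have "vsub H x y = (-1) \<odot> vsub H y x"
    using assms by (intro vec_eqI) simp_all
  thus ?thesis using assms by simp
qed

section \<open>Convergent sequences and the Riesz representation\<close>

definition conv :: "(nat \<Rightarrow> 'a) \<Rightarrow> 'a \<Rightarrow> bool" where
  "conv s l \<longleftrightarrow> (\<forall>n. s n \<in> X) \<and> l \<in> X \<and> (\<lambda>n. \<parallel>vsub H (s n) l\<parallel>) \<longlonglongrightarrow> 0"

text \<open>A Cauchy criterion with an explicit rate: the bound depends only on the smaller index,
  so one null sequence \<open>b\<close> replaces the epsilon argument.\<close>

lemma cauchy_conv:
  assumes s: "\<And>n. s n \<in> X"
    and c: "\<And>m n. m \<le> n \<Longrightarrow> \<parallel>vsub H (s n) (s m)\<parallel> \<le> b m" and b: "b \<longlonglongrightarrow> 0"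
  shows "\<exists>l. conv s l"
proof -
  have "\<exists>l\<in>X. \<forall>e>0. \<exists>N. \<forall>n\<ge>N. hnorm H (vsub H (s n) l) < e"
  proof (rule complete[OF s])
    fix e :: real assume "e > 0"
    then obtain N where N: "\<And>n. n \<ge> N \<Longrightarrow> b n < e"
      using order_tendstoD(2)[OF b] by (metis eventually_sequentially)
    have "\<parallel>vsub H (s m) (s n)\<parallel> < e" if "m \<ge> N" "n \<ge> N" for m n
    proof (cases "m \<le> n")
      case True
      thus ?thesis using c[OF True] N[OF that(1)] nrm_vsub_commute[OF s s, of m n] by simp
    next
      case False
      thus ?thesis using c[of n m] N[OF that(2)] by simp
    qed
    thus "\<exists>N. \<forall>m\<ge>N. \<forall>n\<ge>N. \<parallel>vsub H (s m) (s n)\<parallel> < e" by blast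
  qed
  then obtain l where l: "l \<in> X" "\<forall>e>0. \<exists>N. \<forall>n\<ge>N. \<parallel>vsub H (s n) l\<parallel> < e" by blast
  have "(\<lambda>n. \<parallel>vsub H (s n) l\<parallel>) \<longlonglongrightarrow> 0"
    using l s by (intro LIMSEQ_I) simp
  thus ?thesis using l s by (auto simp: conv_def)
qed

lemma conv_closed: "conv s l \<Longrightarrow> s n \<in> X" "conv s l \<Longrightarrow> l \<in> X"
  by (auto simp: conv_def)

text \<open>Split the difference into (s - l, t - k) + (s - l, k) + (l, t - k) and apply
  Cauchy-Schwarz to each part. Both arguments vary, so the case \<open>t = s\<close> gives
  convergence of norms.\<close>

lemma conv_inner:
  assumes s: "conv s l" and t: "conv t k"
  shows "(\<lambda>n. \<langle>s n, t n\<rangle>) \<longlonglongrightarrow> \<langle>l, k\<rangle>"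
proof -
  note cl = conv_closed[OF s] conv_closed[OF t]
  let ?a = "\<lambda>n. \<parallel>vsub H (s n) l\<parallel>" and ?b = "\<lambda>n. \<parallel>vsub H (t n) k\<parallel>"
  have "norm (\<langle>s n, t n\<rangle> - \<langle>l, k\<rangle>) \<le> ?a n * ?b n + ?a n * \<parallel>k\<parallel> + \<parallel>l\<parallel> * ?b n" for n
  proof -
    have "\<langle>s n, t n\<rangle> - \<langle>l, k\<rangle> = \<langle>vsub H (s n) l, vsub H (t n) k\<rangle> + \<langle>vsub H (s n) l, k\<rangle> + \<langle>l, vsub H (t n) k\<rangle>"
      using cl by (simp add: algebra_simps)
    also have "norm \<dots> \<le> norm \<langle>vsub H (s n) l, vsub H (t n) k\<rangle> + norm \<langle>vsub H (s n) l, k\<rangle> + norm \<langle>l, vsub H (t n) k\<rangle>"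
      by (meson add_right_mono norm_triangle_ineq order_trans)
    also have "\<dots> \<le> ?a n * ?b n + ?a n * \<parallel>k\<parallel> + \<parallel>l\<parallel> * ?b n"
      using cl by (intro add_mono cauchy_schwarz) simp_all
    finally show ?thesis .
  qed
  moreover have "(\<lambda>n. ?a n * ?b n + ?a n * \<parallel>k\<parallel> + \<parallel>l\<parallel> * ?b n) \<longlonglongrightarrow> 0 * 0 + 0 * \<parallel>k\<parallel> + \<parallel>l\<parallel> * 0"
    using s t unfolding conv_def by (intro tendsto_intros) auto
  ultimately have "(\<lambda>n. \<langle>s n, t n\<rangle> - \<langle>l, k\<rangle>) \<longlonglongrightarrow> 0"
    by - (rule null_bound[of _ "\<lambda>n. ?a n * ?b n + ?a n * \<parallel>k\<parallel> + \<parallel>l\<parallel> * ?b n"], simp_all)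
  thus ?thesis by (simp add: LIM_zero_iff)
qed

lemma conv_const: "x \<in> X \<Longrightarrow> conv (\<lambda>_. x) x"
  by (simp add: conv_def hnorm_def)

lemma conv_unique: 
  assumes s: "conv s l" and t: "conv s k" shows "l = k"
proof (rule vec_eqI)
  fix z assume "z \<in> X"
  hence "(\<lambda>n. \<langle>s n, z\<rangle>) \<longlonglongrightarrow> \<langle>l, z\<rangle>" "(\<lambda>n. \<langle>s n, z\<rangle>) \<longlonglongrightarrow> \<langle>k, z\<rangle>"
    using conv_inner[OF s conv_const] conv_inner[OF t conv_const] by auto
  thus "\<langle>l, z\<rangle> = \<langle>k, z\<rangle>" by (rule LIMSEQ_unique)
qed (use assms in \<open>auto simp: conv_def\<close>)

lemma conv_nrm: "conv s l \<Longrightarrow> (\<lambda>n. \<parallel>s n\<parallel>) \<longlonglongrightarrow> \<parallel>l\<parallel>"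
  unfolding hnorm_def using conv_inner[of s l s l] by (intro tendsto_intros)

text \<open>The representing vector is the minimiser of \<open>\<Phi>\<close>, whose minimising sequences are
  Cauchy by the parallelogram law.\<close>
lemma riesz:
  assumes add: "\<And>x y. x \<in> X \<Longrightarrow> y \<in> X \<Longrightarrow> f (x \<oplus> y) = f x + f y"
    and sc: "\<And>a x. x \<in> X \<Longrightarrow> f (a \<odot> x) = a * f x"
    and bd: "\<And>x. x \<in> X \<Longrightarrow> cmod (f x) \<le> C * \<parallel>x\<parallel>"
  shows "\<exists>y\<in>X. \<forall>x\<in>X. f x = \<langle>x, y\<rangle>"
proof -
  \<comment> \<open>If \<open>f\<close> is represented by \<open>y\<close>, then
    \<open>\<Phi> x\<close> equals \<parallel>x - y\<parallel>^2 - \<parallel>y\<parallel>^2, so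
    \<open>y\<close> must be the minimiser.\<close>
  define \<Phi> where "\<Phi> x = Re \<langle>x, x\<rangle> - 2 * Re (f x)" for x
  have below: "- C\<^sup>2 \<le> \<Phi> x" if x: "x \<in> X" for x
  proof -
    have "Re (f x) \<le> C * \<parallel>x\<parallel>" using bd[OF x] complex_Re_le_cmod[of "f x"] by linarith
    moreover have "0 \<le> (\<parallel>x\<parallel> - C)\<^sup>2" by simp
    ultimately show ?thesis using x by (simp add: \<Phi>_def nrm_sq power2_diff mult.commute)
  qed
  define m where "m = (INF x\<in>X. \<Phi> x)"
  have bdd: "bdd_below (\<Phi> ` X)" using below by (intro bdd_belowI2) auto
  have m_le: "m \<le> \<Phi> x" if "x \<in> X" for x
    unfolding m_def using bdd that by (rule cINF_lower)
  have "\<exists>x\<in>X. \<Phi> x < m + inverse (real (Suc n))" for n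
  proof -
    have "m < m + inverse (real (Suc n))" by simp
    thus ?thesis
      using cINF_less_iff[of X \<Phi>, OF _ bdd] zero_closed unfolding m_def by blast
  qed
  then obtain s where s: "\<And>n. s n \<in> X" "\<And>n. \<Phi> (s n) < m + inverse (real (Suc n))" by metis
  \<comment> \<open>Apply the parallelogram law to the midpoint, where \<open>\<Phi>\<close> is at
    least \<open>m\<close>; near-minimal points are therefore close together.\<close>
  have para: "Re \<langle>vsub H x y, vsub H x y\<rangle> \<le> 2 * \<Phi> x + 2 * \<Phi> y - 4 * m" if x: "x \<in> X" and y: "y \<in> X" for x y
  proof -
    have "4 * \<Phi> ((1/2) \<odot> (x \<oplus> y)) = 2 * \<Phi> x + 2 * \<Phi> y - Re \<langle>vsub H x y, vsub H x y\<rangle>"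
      using x y by (simp add: \<Phi>_def add sc field_simps)
    thus ?thesis using m_le[of "(1/2) \<odot> (x \<oplus> y)"] x y by simp
  qed
  have "\<exists>l. conv s l"
  proof (rule cauchy_conv)
    fix i j :: nat assume "i \<le> j"
    hence "inverse (real (Suc j)) \<le> inverse (real (Suc i))" by simp
    hence "Re \<langle>vsub H (s j) (s i), vsub H (s j) (s i)\<rangle> \<le> 4 * inverse (real (Suc i))"
      using para[OF s(1) s(1), of j i] s(2)[of i] s(2)[of j] by linarith
    thus "\<parallel>vsub H (s j) (s i)\<parallel> \<le> sqrt (4 * inverse (real (Suc i)))"
      by (simp add: hnorm_def)
  next
    have "(\<lambda>i. sqrt (4 * inverse (real (Suc i)))) \<longlonglongrightarrow> sqrt (4 * 0)"
      by (intro tendsto_intros LIMSEQ_inverse_real_of_nat)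
    thus "(\<lambda>i. sqrt (4 * inverse (real (Suc i)))) \<longlonglongrightarrow> 0" by simp
  qed (rule s)
  then obtain l where l: "conv s l" by blast
  note lX = conv_closed(2)[OF l]
  have "(\<lambda>n. f (s n)) \<longlonglongrightarrow> f l"
  proof -
    have "norm (f (s n) - f l) \<le> C * \<parallel>vsub H (s n) l\<parallel>" for n
      using bd[of "vsub H (s n) l"] s(1) lX by (simp add: vsub_def add sc)
    moreover have "(\<lambda>n. C * \<parallel>vsub H (s n) l\<parallel>) \<longlonglongrightarrow> C * 0"
      using l unfolding conv_def by (intro tendsto_intros) auto
    ultimately have "(\<lambda>n. f (s n) - f l) \<longlonglongrightarrow> 0"
      by - (rule null_bound[of _ "\<lambda>n. C * \<parallel>vsub H (s n) l\<parallel>"], simp_all)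
    thus ?thesis by (simp add: LIM_zero_iff)
  qed
  hence lim1: "(\<lambda>n. \<Phi> (s n)) \<longlonglongrightarrow> \<Phi> l"
    unfolding \<Phi>_def using conv_inner[OF l l] by (intro tendsto_intros)
  have "(\<lambda>n. m + inverse (real (Suc n))) \<longlonglongrightarrow> m + 0"
    by (intro tendsto_intros LIMSEQ_inverse_real_of_nat)
  hence "\<Phi> l \<le> m + 0"
    by (rule LIMSEQ_le[OF lim1]) (use s(2) less_imp_le in blast)
  hence min: "\<Phi> l \<le> \<Phi> x" if "x \<in> X" for x using m_le[OF that] by simp
  have re: "Re (f z) = Re \<langle>z, l\<rangle>" if z: "z \<in> X" for z
  proof -
    define p where "p = Re \<langle>z, l\<rangle> - Re (f z)"
    \<comment> \<open>First variation of \<open>\<Phi>\<close> at the minimiser \<open>l\<close> in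
      the direction \<open>z\<close>: the right side is \<open>\<Phi>\<close> at l + t z minus
      \<open>\<Phi>\<close> at \<open>l\<close>.\<close>
    have ge: "0 \<le> t * t * Re \<langle>z, z\<rangle> + 2 * t * p" for t :: real
      using min[of "l \<oplus> complex_of_real t \<odot> z"] lX z Re_inner_commute[OF lX z]
      by (simp add: \<Phi>_def add sc p_def algebra_simps)
    have "p = 0"
    proof (rule ccontr)
      assume "p \<noteq> 0"
      \<comment> \<open>\<open>q\<close> lies strictly above \<parallel>z\<parallel>^2 and is
        positive even for z = 0, so t = - p / q is a legitimate choice that makes the quadratic
        negative.\<close>
      define q where "q = Re \<langle>z, z\<rangle> + 1"
      have q: "q > 0" "Re \<langle>z, z\<rangle> < q" using z by (simp_all add: q_def add_nonneg_pos)
      have "0 \<le> p\<^sup>2 / q\<^sup>2 * Re \<langle>z, z\<rangle> - 2 * p\<^sup>2 / q"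
        using ge[of "- p / q"] by (simp add: power2_eq_square)
      also have "\<dots> = p\<^sup>2 / q\<^sup>2 * (Re \<langle>z, z\<rangle> - 2 * q)"
        using q by (simp add: field_simps power2_eq_square)
      finally show False
        using q \<open>p \<noteq> 0\<close> zero_less_power2[of p] by (simp add: zero_le_mult_iff zero_le_divide_iff)
    qed
    thus ?thesis by (simp add: p_def)
  qed
  \<comment> \<open>The real parts at i z are minus the imaginary parts at z, so the real identity
    gives the complex one.\<close>
  have "f z = \<langle>z, l\<rangle>" if z: "z \<in> X" for z
    using re[OF z] re[of "\<i> \<odot> z"] z lX by (simp add: sc complex_eq_iff)
  thus ?thesis using lX by blast
qed

end

section \<open>Bounded operators and adjoints\<close>

lemma bounded_opD:
  assumes "bounded_op H K T"
  shows "x \<in> carrier H \<Longrightarrow> T x \<in> carrier K"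
    and "\<lbrakk>x \<in> carrier H; y \<in> carrier H\<rbrakk> \<Longrightarrow> T (vadd H x y) = vadd K (T x) (T y)"
    and "x \<in> carrier H \<Longrightarrow> T (vscale H a x) = vscale K a (T x)"
  using assms by (auto simp: bounded_op_def)

lemma bounded_opI:
  assumes "\<And>x. x \<in> carrier H \<Longrightarrow> T x \<in> carrier K"
    and "\<And>x y. \<lbrakk>x \<in> carrier H; y \<in> carrier H\<rbrakk> \<Longrightarrow> T (vadd H x y) = vadd K (T x) (T y)"
    and "\<And>a x. x \<in> carrier H \<Longrightarrow> T (vscale H a x) = vscale K a (T x)"
    and "\<And>x. x \<in> carrier H \<Longrightarrow> hnorm K (T x) \<le> C * hnorm H x"
  shows "bounded_op H K T"
  using assms unfolding bounded_op_def by blast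

lemma bounded_op_vsub:
  "\<lbrakk>bounded_op H K T; hilbert H; x \<in> carrier H; y \<in> carrier H\<rbrakk> \<Longrightarrow> T (vsub H x y) = vsub K (T x) (T y)"
  by (simp add: vsub_def bounded_opD hilbert.scale_closed)

lemma bounded_op_bound:
  assumes "bounded_op H K T" "hilbert H"
  obtains C where "0 \<le> C" "\<And>x. x \<in> carrier H \<Longrightarrow> hnorm K (T x) \<le> C * hnorm H x"
proof -
  interpret hilbert H by fact
  obtain C where C: "\<And>x. x \<in> X \<Longrightarrow> hnorm K (T x) \<le> C * \<parallel>x\<parallel>"
    using assms(1) unfolding bounded_op_def by blast
  have "hnorm K (T x) \<le> \<bar>C\<bar> * \<parallel>x\<parallel>" if "x \<in> X" for x
    using C[OF that] mult_right_mono[OF abs_ge_self[of C] nrm_nonneg[OF that]] by linarith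
  thus thesis using that[of "\<bar>C\<bar>"] by simp
qed

text \<open>The Riesz vector of the functional that sends \<open>x\<close> to the inner product of
  \<open>T x\<close> with \<open>y\<close> serves as \<open>S y\<close>. Linearity of
  \<open>S\<close> follows from uniqueness of that vector.\<close>

lemma adjoint_exists:
  assumes H: "hilbert H" and K: "hilbert K" and T: "bounded_op H K T"
  shows "\<exists>S. is_adjoint H K T S"
proof -
  interpret H: hilbert H by fact
  interpret K: hilbert K by fact
  note [simp] = bounded_opD[OF T]
  obtain C where C: "0 \<le> C" "\<And>x. x \<in> carrier H \<Longrightarrow> hnorm K (T x) \<le> C * hnorm H x"
    using bounded_op_bound[OF T H] by blast
  have "\<exists>z\<in>carrier H. \<forall>x\<in>carrier H. cinner K (T x) y = cinner H x z" if y: "y \<in> carrier K" for y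
  proof (rule H.riesz)
    fix x assume x: "x \<in> carrier H"
    have "cmod (cinner K (T x) y) \<le> hnorm K (T x) * hnorm K y"
      using x y by (simp add: K.cauchy_schwarz)
    also have "\<dots> \<le> (C * hnorm H x) * hnorm K y"
      using C(2)[OF x] y by (simp add: mult_right_mono)
    finally show "cmod (cinner K (T x) y) \<le> (C * hnorm K y) * hnorm H x" by (simp add: mult_ac)
  qed (use y in simp_all)
  then obtain S where S: "\<And>y. y \<in> carrier K \<Longrightarrow> S y \<in> carrier H"
    "\<And>x y. x \<in> carrier H \<Longrightarrow> y \<in> carrier K \<Longrightarrow> cinner K (T x) y = cinner H x (S y)"
    by metis
  have S': "cinner H (S y) x = cinner K y (T x)" if "x \<in> carrier H" "y \<in> carrier K" for x y
    using S that H.inner_sym[of "S y" x] K.inner_sym[of y "T x"] by simp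
  have "bounded_op K H S"
  proof (rule bounded_opI)
    fix y assume y: "y \<in> carrier K"
    \<comment> \<open>The bound for \<open>T\<close>, applied at the vector \<open>S y\<close>,
      bounds \<parallel>S y\<parallel>^2 by C \<parallel>S y\<parallel> \<parallel>y\<parallel>; one
      factor \<parallel>S y\<parallel> then cancels unless it is zero.\<close>
    have "(hnorm H (S y))\<^sup>2 = Re (cinner K (T (S y)) y)"
      using S y by (simp add: H.nrm_sq)
    also have "\<dots> \<le> hnorm K (T (S y)) * hnorm K y"
      using S(1) y by (intro K.Re_inner_le) simp_all
    also have "\<dots> \<le> (C * hnorm H (S y)) * hnorm K y"
      using C(2)[OF S(1)[OF y]] y by (simp add: mult_right_mono)
    finally have le: "hnorm H (S y) * hnorm H (S y) \<le> hnorm H (S y) * (C * hnorm K y)"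
      by (simp add: power2_eq_square mult_ac)
    show "hnorm H (S y) \<le> C * hnorm K y"
    proof (cases "hnorm H (S y) = 0")
      case True thus ?thesis using C(1) y by simp
    next
      case False
      thus ?thesis using le S(1)[OF y] by (simp add: mult_le_cancel_left_pos order_less_le)
    qed
  next
    fix x y assume "x \<in> carrier K" "y \<in> carrier K"
    thus "S (vadd K x y) = vadd H (S x) (S y)"
      using S(1) by (intro H.vec_eqI) (simp_all add: S')
  next
    fix a x assume "x \<in> carrier K"
    thus "S (vscale K a x) = vscale H a (S x)"
      using S(1) by (intro H.vec_eqI) (simp_all add: S')
  qed (rule S)
  thus ?thesis using T S(2) unfolding is_adjoint_def by blast
qed

lemma adj_is_adjoint: "\<lbrakk>hilbert H; hilbert K; bounded_op H K T\<rbrakk> \<Longrightarrow> is_adjoint H K T (adj H K T)"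
  using someI_ex[OF adjoint_exists] by (simp add: adj_def)

lemma is_adjointD:
  assumes "is_adjoint H K T S"
  shows "bounded_op H K T" "bounded_op K H S"
    "\<lbrakk>x \<in> carrier H; y \<in> carrier K\<rbrakk> \<Longrightarrow> cinner K (T x) y = cinner H x (S y)"
  using assms by (auto simp: is_adjoint_def)

lemma is_adjoint_sym:
  assumes H: "hilbert H" and K: "hilbert K" and T: "is_adjoint H K T S"
  shows "is_adjoint K H S T"
proof -
  interpret H: hilbert H by fact
  interpret K: hilbert K by fact
  note TD = is_adjointD[OF T]
  have "cinner H (S y) x = cinner K y (T x)" if "x \<in> carrier H" "y \<in> carrier K" for x y
    using TD(3)[OF that] that bounded_opD(1)[OF TD(1)] bounded_opD(1)[OF TD(2)]
      H.inner_sym[of "S y" x] K.inner_sym[of y "T x"] by simp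
  thus ?thesis using TD by (simp add: is_adjoint_def)
qed

lemma adjoint_unique:
  assumes H: "hilbert H" and K: "hilbert K" and S: "is_adjoint H K T S" and S': "is_adjoint H K T S'" and y: "y \<in> carrier K"
  shows "S y = S' y"
proof -
  interpret H: hilbert H by fact
  note [simp] = bounded_opD(1)[OF is_adjointD(2)[OF S]] bounded_opD(1)[OF is_adjointD(2)[OF S']]
  show ?thesis
  proof (rule H.vec_eqI)
    fix z assume "z \<in> carrier H"
    thus "cinner H (S y) z = cinner H (S' y) z"
      using y is_adjointD(3)[OF is_adjoint_sym[OF H K S]] is_adjointD(3)[OF is_adjoint_sym[OF H K S']] by simp
  qed (use y in simp_all)
qed

text \<open>\<open>adj\<close> is a choice that is unique only on the carrier. This rule exchanges
  it, pointwise there, for an adjoint that is known explicitly.\<close>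

lemma adj_eq:
  assumes "hilbert H" "hilbert K" "is_adjoint H K T S" "y \<in> carrier K"
  shows "adj H K T y = S y"
  using adjoint_unique[OF assms(1,2) adj_is_adjoint[OF assms(1,2) is_adjointD(1)[OF assms(3)]] assms(3,4)] .

lemma bounded_op_comp:
  assumes "hilbert H" and "hilbert K" and T: "bounded_op H K T" and S: "bounded_op K L S"
  shows "bounded_op H L (\<lambda>x. S (T x))"
proof -
  obtain C D where C: "\<And>x. x \<in> carrier H \<Longrightarrow> hnorm K (T x) \<le> C * hnorm H x"
    and D: "0 \<le> D" "\<And>x. x \<in> carrier K \<Longrightarrow> hnorm L (S x) \<le> D * hnorm K x"
    using bounded_op_bound[OF T] bounded_op_bound[OF S] assms(1,2) by metis
  show ?thesis
  proof (rule bounded_opI)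
    fix x assume x: "x \<in> carrier H"
    show "hnorm L (S (T x)) \<le> (D * C) * hnorm H x"
      using D(2)[OF bounded_opD(1)[OF T x]] mult_left_mono[OF C[OF x] D(1)] by (simp add: mult_ac)
  qed (use bounded_opD[OF T] bounded_opD[OF S] in simp_all)
qed

lemma is_adjoint_comp:
  assumes H: "hilbert H" and K: "hilbert K" and L: "hilbert L"
    and T: "is_adjoint H K T T'" and S: "is_adjoint K L S S'"
  shows "is_adjoint H L (\<lambda>x. S (T x)) (\<lambda>y. T' (S' y))"
  unfolding is_adjoint_def
  using bounded_op_comp[OF H K is_adjointD(1)[OF T] is_adjointD(1)[OF S]]
    bounded_op_comp[OF L K is_adjointD(2)[OF S] is_adjointD(2)[OF T]]
    bounded_opD(1)[OF is_adjointD(1)[OF T]] bounded_opD(1)[OF is_adjointD(2)[OF S]]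
    is_adjointD(3)[OF T] is_adjointD(3)[OF S] by simp

context hilbert
begin

abbreviation bop where "bop T \<equiv> bounded_op H H T"

lemma hilbert_self: "hilbert H"
  by unfold_locales

lemma bounded_op_comb:
  assumes T: "bounded_op L H T" and S: "bounded_op L H S"
  shows "bounded_op L H (\<lambda>x. a \<odot> T x \<oplus> b \<odot> S x)"
proof -
  note [simp] = bounded_opD[OF T] bounded_opD[OF S]
  obtain C D where C: "\<And>x. x \<in> carrier L \<Longrightarrow> \<parallel>T x\<parallel> \<le> C * hnorm L x"
    and D: "\<And>x. x \<in> carrier L \<Longrightarrow> \<parallel>S x\<parallel> \<le> D * hnorm L x"
    using T S unfolding bounded_op_def by metis
  show ?thesis
  proof (rule bounded_opI)
    fix x assume x: "x \<in> carrier L"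
    have "\<parallel>a \<odot> T x \<oplus> b \<odot> S x\<parallel> \<le> cmod a * \<parallel>T x\<parallel> + cmod b * \<parallel>S x\<parallel>"
      using triangle[of "a \<odot> T x" "b \<odot> S x"] x by simp
    also have "\<dots> \<le> cmod a * (C * hnorm L x) + cmod b * (D * hnorm L x)"
      using C[OF x] D[OF x] by (intro add_mono mult_left_mono) simp_all
    finally show "\<parallel>a \<odot> T x \<oplus> b \<odot> S x\<parallel> \<le> (cmod a * C + cmod b * D) * hnorm L x"
      by (simp add: algebra_simps)
  next
    fix x y assume "x \<in> carrier L" "y \<in> carrier L"
    thus "a \<odot> T (vadd L x y) \<oplus> b \<odot> S (vadd L x y) = (a \<odot> T x \<oplus> b \<odot> S x) \<oplus> (a \<odot> T y \<oplus> b \<odot> S y)"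
      by (intro vec_eqI) (simp_all add: algebra_simps)
  next
    fix c x assume "x \<in> carrier L"
    thus "a \<odot> T (vscale L c x) \<oplus> b \<odot> S (vscale L c x) = c \<odot> (a \<odot> T x \<oplus> b \<odot> S x)"
      by (intro vec_eqI) (simp_all add: algebra_simps)
  qed simp_all
qed

lemma bop_id: "bop (\<lambda>x. x)"
  by (rule bounded_opI[where C = 1]) simp_all

lemma nrm_zero [simp]: "\<parallel>vzero H\<parallel> = 0"
  by (simp add: hnorm_def)

lemma bounded_op_zero: "bounded_op L H (\<lambda>_. vzero H)"
  by (rule bounded_opI[where C = 0]) (auto intro: vec_eqI)

lemma bop_vsub: "\<lbrakk>bop T; bop S\<rbrakk> \<Longrightarrow> bop (\<lambda>x. vsub H (T x) (S x))"
proof -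
  assume T: "bop T" and S: "bop S"
  have "bounded_op H H (\<lambda>x. 1 \<odot> T x \<oplus> (-1) \<odot> S x)" by (rule bounded_op_comb[OF T S])
  thus ?thesis
    using bounded_opD(1)[OF T] by (simp add: vsub_def bounded_op_def)
qed

lemma bop_comp: "\<lbrakk>bop T; bop S\<rbrakk> \<Longrightarrow> bop (\<lambda>x. S (T x))"
  using bounded_op_comp[OF hilbert_self hilbert_self] .

lemma conv_bop:
  assumes A: "bop A" and s: "conv s l"
  shows "conv (\<lambda>n. A (s n)) (A l)"
proof -
  obtain C where C: "\<And>x. x \<in> X \<Longrightarrow> \<parallel>A x\<parallel> \<le> C * \<parallel>x\<parallel>"
    using bounded_op_bound[OF A hilbert_self] by blast
  note cl = conv_closed[OF s] bounded_opD(1)[OF A]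
  have "(\<lambda>n. \<parallel>vsub H (A (s n)) (A l)\<parallel>) \<longlonglongrightarrow> 0"
  proof (rule null_bound)
    show "norm \<parallel>vsub H (A (s n)) (A l)\<parallel> \<le> C * \<parallel>vsub H (s n) l\<parallel>" for n
      using C[of "vsub H (s n) l"] cl by (simp add: bounded_op_vsub[OF A hilbert_self])
    have "(\<lambda>n. C * \<parallel>vsub H (s n) l\<parallel>) \<longlonglongrightarrow> C * 0"
      using s unfolding conv_def by (intro tendsto_intros) auto
    thus "(\<lambda>n. C * \<parallel>vsub H (s n) l\<parallel>) \<longlonglongrightarrow> 0" by simp
  qed
  thus ?thesis using cl by (simp add: conv_def)
qed

section \<open>Square roots of positive contractions\<close>

text \<open>With \<open>B' = 1 - B\<close>, this is \<open>B - B\<^sup>2 = B B' B + B' B B' \<ge> 0\<close>.\<close>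
lemma pos_contraction:
  assumes B: "bop B" and sa: "\<And>x y. \<lbrakk>x \<in> X; y \<in> X\<rbrakk> \<Longrightarrow> \<langle>B x, y\<rangle> = \<langle>x, B y\<rangle>"
    and pos: "\<And>x. x \<in> X \<Longrightarrow> 0 \<le> Re \<langle>B x, x\<rangle>" and le: "\<And>x. x \<in> X \<Longrightarrow> Re \<langle>B x, x\<rangle> \<le> Re \<langle>x, x\<rangle>"
    and x: "x \<in> X"
  shows "\<parallel>B x\<parallel> \<le> \<parallel>x\<parallel>"
proof -
  note [simp] = bounded_opD[OF B] bounded_op_vsub[OF B hilbert_self]
  have "0 \<le> (Re \<langle>B x, B x\<rangle> - Re \<langle>B (B x), B x\<rangle>) + Re \<langle>B (vsub H x (B x)), vsub H x (B x)\<rangle>"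
    using le[of "B x"] pos[of "vsub H x (B x)"] x by (simp del: inner_vsub_left inner_vsub_right)
  also have "\<dots> = Re \<langle>B x, x\<rangle> - Re \<langle>B x, B x\<rangle>"
    using x by (simp add: sa)
  finally have "\<parallel>B x\<parallel>\<^sup>2 \<le> \<parallel>x\<parallel>\<^sup>2"
    using le[OF x] x by (simp add: nrm_sq)
  thus ?thesis using x by simp
qed

text \<open>With \<open>Z = 1 - B\<close>, the root is \<open>1 - W\<close> where \<open>W = (Z + W\<^sup>2)/2\<close> is the limit of the
  corresponding iteration; the scalar iteration \<open>t\<close> started from \<open>\<parallel>Z\<parallel> \<le> 1\<close> majorises it.\<close>
lemma sqrt_exists:
  assumes B: "bop B" and sa: "\<And>x y. \<lbrakk>x \<in> X; y \<in> X\<rbrakk> \<Longrightarrow> \<langle>B x, y\<rangle> = \<langle>x, B y\<rangle>"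
    and pos: "\<And>x. x \<in> X \<Longrightarrow> 0 \<le> Re \<langle>B x, x\<rangle>" and le: "\<And>x. x \<in> X \<Longrightarrow> Re \<langle>B x, x\<rangle> \<le> Re \<langle>x, x\<rangle>"
  obtains R where "bop R" "\<And>x y. \<lbrakk>x \<in> X; y \<in> X\<rbrakk> \<Longrightarrow> \<langle>R x, y\<rangle> = \<langle>x, R y\<rangle>"
    "\<And>x. x \<in> X \<Longrightarrow> R (R x) = B x"
    "\<And>A x. \<lbrakk>bop A; \<And>x. x \<in> X \<Longrightarrow> A (B x) = B (A x); x \<in> X\<rbrakk> \<Longrightarrow> A (R x) = R (A x)"
proof -
  define Z where "Z x = vsub H x (B x)" for x
  have Z: "bop Z" unfolding Z_def by (rule bop_vsub[OF bop_id B])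
  note [simp] = bounded_opD[OF B] bounded_opD[OF Z]
  have Zsa: "\<langle>Z x, y\<rangle> = \<langle>x, Z y\<rangle>" if "x \<in> X" "y \<in> X" for x y
    using that sa by (simp add: Z_def)
  have Zn: "\<parallel>Z x\<parallel> \<le> \<parallel>x\<parallel>" if "x \<in> X" for x
    by (rule pos_contraction[OF Z Zsa]) (use that pos le in \<open>simp_all add: Z_def\<close>)
  \<comment> \<open>The iteration sends Y to (Z + Y^2)/2, starting from 0. Each \<open>Y n\<close>
    is a polynomial in \<open>Z\<close>, which accounts for its self-adjointness and for the
    commutation facts that follow.\<close>
  define Y :: "nat \<Rightarrow> 'a \<Rightarrow> 'a" where "Y = rec_nat (\<lambda>x. vzero H) (\<lambda>n y x. (1/2) \<odot> Z x \<oplus> (1/2) \<odot> y (y x))"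
  have Y0: "Y 0 = (\<lambda>x. vzero H)" and YS: "Y (Suc n) = (\<lambda>x. (1/2) \<odot> Z x \<oplus> (1/2) \<odot> Y n (Y n x))" for n
    by (simp_all add: Y_def)
  have Y: "bop (Y n)" for n
    by (induction n) (simp_all add: Y0 YS bounded_op_zero bounded_op_comb[OF Z bop_comp])
  note [simp] = bounded_opD[OF Y]
  have Ysa: "\<langle>Y n x, y\<rangle> = \<langle>x, Y n y\<rangle>" if "x \<in> X" "y \<in> X" for n x y
    using that by (induction n arbitrary: x y) (simp_all add: Y0 YS Zsa)
  have Ycomm: "A (Y n x) = Y n (A x)" if A: "bop A" and AZ: "\<And>x. x \<in> X \<Longrightarrow> A (Z x) = Z (A x)" and x: "x \<in> X" for A n x
    using x
  proof (induction n arbitrary: x)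
    case 0
    thus ?case using bounded_opD(3)[OF A, of "vzero H" 0] bounded_opD(1)[OF A] by (simp add: Y0 scale_zero_left)
  next
    case (Suc n)
    thus ?case using bounded_opD[OF A] by (simp add: YS AZ)
  qed
  have YZ: "Y n (Z x) = Z (Y n x)" if "x \<in> X" for n x
    using Ycomm[OF Z] that by simp
  have YY: "Y m (Y n x) = Y n (Y m x)" if "x \<in> X" for m n x
    using Ycomm[OF Y[of m] YZ] that by simp
  \<comment> \<open>The same iteration with the number 1 in place of \<open>Z\<close>.\<close>
  define t :: "nat \<Rightarrow> real" where "t = rec_nat 0 (\<lambda>n s. (1 + s\<^sup>2) / 2)"
  have t0: "t 0 = 0" and tS: "t (Suc n) = (1 + (t n)\<^sup>2) / 2" for n
    by (simp_all add: t_def)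
  have t1: "0 \<le> t n \<and> t n \<le> 1" for n
    by (induction n) (simp_all add: t0 tS power_le_one)
  have Yn: "\<parallel>Y n x\<parallel> \<le> t n * \<parallel>x\<parallel>" if "x \<in> X" for n x
    using that
  proof (induction n arbitrary: x)
    case (Suc n)
    have "\<parallel>Y n (Y n x)\<parallel> \<le> t n * \<parallel>Y n x\<parallel>" using Suc by simp
    also have "\<dots> \<le> t n * (t n * \<parallel>x\<parallel>)" using Suc t1 by (simp add: mult_left_mono)
    finally have "\<parallel>Y n (Y n x)\<parallel> \<le> (t n)\<^sup>2 * \<parallel>x\<parallel>" by (simp add: power2_eq_square)
    thus ?case
      using triangle[of "(1/2) \<odot> Z x" "(1/2) \<odot> Y n (Y n x)"] Zn[of x] Suc.prems
      by (simp add: YS tS field_simps)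
  qed (simp add: Y0 t0)
  have Yd: "\<parallel>vsub H (Y (Suc n) x) (Y n x)\<parallel> \<le> (t (Suc n) - t n) * \<parallel>x\<parallel>" if "x \<in> X" for n x
    using that
  proof (induction n)
    case 0
    have "vsub H (Y (Suc 0) x) (Y 0 x) = (1/2) \<odot> Z x"
      using 0 by (intro vec_eqI) (simp_all add: Y0 YS)
    thus ?case using Zn[OF 0] 0 by (simp add: t0 tS)
  next
    case (Suc n)
    let ?d = "vsub H (Y (Suc n) x) (Y n x)"
    have d: "?d \<in> X" using Suc by simp
    \<comment> \<open>As \<open>Y (Suc n)\<close> and \<open>Y n\<close> commute, half the
      difference of their squares factors as half their sum applied to their difference. The
      increments of \<open>t\<close> factor in the same way, which closes the induction.\<close>
    have "vsub H (Y (Suc (Suc n)) x) (Y (Suc n) x) = (1/2) \<odot> (Y (Suc n) ?d \<oplus> Y n ?d)"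
      using Suc.prems YY[of x "Suc n" n] unfolding YS[of "Suc n"] YS[of n, THEN fun_cong, of x]
      by (intro vec_eqI) (simp_all add: bounded_op_vsub[OF Y hilbert_self])
    hence "\<parallel>vsub H (Y (Suc (Suc n)) x) (Y (Suc n) x)\<parallel> \<le> (\<parallel>Y (Suc n) ?d\<parallel> + \<parallel>Y n ?d\<parallel>) / 2"
      using triangle[of "Y (Suc n) ?d" "Y n ?d"] d by simp
    also have "\<dots> \<le> (t (Suc n) * \<parallel>?d\<parallel> + t n * \<parallel>?d\<parallel>) / 2"
      using Yn[OF d] by (simp add: add_mono)
    also have "\<dots> = (t (Suc n) + t n) / 2 * \<parallel>?d\<parallel>" by (simp add: field_simps)
    also have "\<dots> \<le> (t (Suc n) + t n) / 2 * ((t (Suc n) - t n) * \<parallel>x\<parallel>)"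
      using Suc t1 by (intro mult_left_mono) simp_all
    also have "\<dots> = (t (Suc (Suc n)) - t (Suc n)) * \<parallel>x\<parallel>"
      by (simp add: tS[of "Suc n"] tS[of n, symmetric] power2_eq_square field_simps) (simp add: tS power2_eq_square field_simps)
    finally show ?case .
  qed
  have Ycauchy: "\<parallel>vsub H (Y n x) (Y m x)\<parallel> \<le> (t n - t m) * \<parallel>x\<parallel>" if "m \<le> n" "x \<in> X" for m n x
    using that(1)
  proof (induction n rule: dec_induct)
    case base
    have "vsub H (Y m x) (Y m x) = vzero H" using that(2) by (intro vec_eqI) simp_all
    thus ?case by simp
  next
    case (step n)
    thus ?case
      using nrm_vsub_triangle[of "Y (Suc n) x" "Y n x" "Y m x"] Yd[OF that(2), of n] that(2)
      by (simp add: algebra_simps)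
  qed
  have "t n \<le> t (Suc n)" for n
  proof -
    have "0 \<le> (1 - t n)\<^sup>2" by simp
    thus ?thesis by (simp add: tS power2_diff)
  qed
  hence "incseq t" by (simp add: incseq_Suc_iff)
  \<comment> \<open>\<open>t\<close> increases and is bounded by 1. Replacing \<open>t n\<close> by
    its limit makes the Cauchy bound depend on the smaller index alone, as
    \<open>cauchy_conv\<close> asks.\<close>
  then obtain \<tau> where \<tau>: "t \<longlonglongrightarrow> \<tau>" "\<And>n. t n \<le> \<tau>"
    using incseq_convergent[of t 1] t1 by blast
  have "\<exists>l. conv (\<lambda>n. Y n x) l" if "x \<in> X" for x
  proof (rule cauchy_conv)
    show "\<parallel>vsub H (Y n x) (Y m x)\<parallel> \<le> (\<tau> - t m) * \<parallel>x\<parallel>" if "m \<le> n" for m n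
      using Ycauchy[OF that \<open>x \<in> X\<close>] mult_right_mono[of "t n - t m" "\<tau> - t m" "\<parallel>x\<parallel>"] \<tau>(2)[of n] \<open>x \<in> X\<close> by simp
    have "(\<lambda>m. (\<tau> - t m) * \<parallel>x\<parallel>) \<longlonglongrightarrow> (\<tau> - \<tau>) * \<parallel>x\<parallel>"
      by (intro tendsto_intros \<tau>)
    thus "(\<lambda>m. (\<tau> - t m) * \<parallel>x\<parallel>) \<longlonglongrightarrow> 0" by simp
  qed (use that in simp)
  then obtain W where W: "\<And>x. x \<in> X \<Longrightarrow> conv (\<lambda>n. Y n x) (W x)" by metis
  have WX [simp]: "W x \<in> X" if "x \<in> X" for x using W[OF that] by (rule conv_closed)
  have Wlim: "(\<lambda>n. \<langle>Y n x, z\<rangle>) \<longlonglongrightarrow> \<langle>W x, z\<rangle>" if "x \<in> X" "z \<in> X" for x z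
    using conv_inner[OF W[OF that(1)] conv_const[OF that(2)]] .
  have Wb: "bop W"
  proof (rule bounded_opI)
    fix x assume x: "x \<in> X"
    show "\<parallel>W x\<parallel> \<le> 1 * \<parallel>x\<parallel>"
    proof (rule LIMSEQ_le_const2[OF conv_nrm[OF W[OF x]]], intro exI allI impI)
      fix n
      show "\<parallel>Y n x\<parallel> \<le> 1 * \<parallel>x\<parallel>"
        using Yn[OF x, of n] mult_right_mono[of "t n" 1 "\<parallel>x\<parallel>"] t1 x by simp
    qed
  next
    fix x y assume xy: "x \<in> X" "y \<in> X"
    show "W (x \<oplus> y) = W x \<oplus> W y"
    proof (rule vec_eqI)
      fix z assume z: "z \<in> X"
      have "(\<lambda>n. \<langle>Y n (x \<oplus> y), z\<rangle>) \<longlonglongrightarrow> \<langle>W x, z\<rangle> + \<langle>W y, z\<rangle>"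
        using xy z tendsto_add[OF Wlim Wlim] by simp
      thus "\<langle>W (x \<oplus> y), z\<rangle> = \<langle>W x \<oplus> W y, z\<rangle>"
        using LIMSEQ_unique[OF Wlim[of "x \<oplus> y" z]] xy z by simp
    qed (use xy in simp_all)
  next
    fix a x assume x: "x \<in> X"
    show "W (a \<odot> x) = a \<odot> W x"
    proof (rule vec_eqI)
      fix z assume z: "z \<in> X"
      have "(\<lambda>n. \<langle>Y n (a \<odot> x), z\<rangle>) \<longlonglongrightarrow> a * \<langle>W x, z\<rangle>"
        using x z tendsto_mult[OF tendsto_const Wlim] by simp
      thus "\<langle>W (a \<odot> x), z\<rangle> = \<langle>a \<odot> W x, z\<rangle>"
        using LIMSEQ_unique[OF Wlim[of "a \<odot> x" z]] x z by simp
    qed (use x in simp_all)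
  qed simp
  have Wsa: "\<langle>W x, y\<rangle> = \<langle>x, W y\<rangle>" if "x \<in> X" "y \<in> X" for x y
  proof -
    have "(\<lambda>n. \<langle>Y n x, y\<rangle>) \<longlonglongrightarrow> \<langle>x, W y\<rangle>"
      using conv_inner[OF conv_const W, of x y] that by (simp add: Ysa)
    thus ?thesis using LIMSEQ_unique[OF Wlim] that by blast
  qed
  \<comment> \<open>Self-adjointness moves one factor of the square to the other side, so the limit
    is taken in the inner product of \<open>Y n x\<close> with \<open>Y n z\<close>, where joint
    continuity applies.\<close>
  have Wfix: "W x = (1/2) \<odot> Z x \<oplus> (1/2) \<odot> W (W x)" if x: "x \<in> X" for x
  proof (rule vec_eqI)
    fix z assume z: "z \<in> X"
    have "(\<lambda>n. (1/2) * \<langle>Z x, z\<rangle> + (1/2) * \<langle>Y n x, Y n z\<rangle>) \<longlonglongrightarrow> (1/2) * \<langle>Z x, z\<rangle> + (1/2) * \<langle>W x, W z\<rangle>"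
      by (intro tendsto_intros conv_inner W x z)
    hence "(\<lambda>n. \<langle>Y (Suc n) x, z\<rangle>) \<longlonglongrightarrow> (1/2) * \<langle>Z x, z\<rangle> + (1/2) * \<langle>W x, W z\<rangle>"
      using x z by (simp add: YS Ysa)
    thus "\<langle>W x, z\<rangle> = \<langle>(1/2) \<odot> Z x \<oplus> (1/2) \<odot> W (W x), z\<rangle>"
      using LIMSEQ_unique[OF LIMSEQ_Suc[OF Wlim]] x z by (simp add: Wsa)
  qed (use x in simp_all)
  \<comment> \<open>The fixed point equation gives (1 - W)^2 = 1 - 2 W + W^2 = 1 - Z = B.\<close>
  define R where "R x = vsub H x (W x)" for x
  show thesis
  proof (rule that)
    show R: "bop R" unfolding R_def by (rule bop_vsub[OF bop_id Wb])
    show "\<langle>R x, y\<rangle> = \<langle>x, R y\<rangle>" if "x \<in> X" "y \<in> X" for x y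
      using that by (simp add: R_def Wsa)
    show "R (R x) = B x" if x: "x \<in> X" for x
    proof (rule vec_eqI)
      fix z assume z: "z \<in> X"
      have "\<langle>W x, z\<rangle> = (1/2) * \<langle>Z x, z\<rangle> + (1/2) * \<langle>W (W x), z\<rangle>"
        using arg_cong[OF Wfix[OF x], of "\<lambda>u. \<langle>u, z\<rangle>"] x z by simp
      thus "\<langle>R (R x), z\<rangle> = \<langle>B x, z\<rangle>"
        using x z by (simp add: R_def bounded_op_vsub[OF Wb hilbert_self] Z_def field_simps)
    qed (use x in \<open>simp_all add: R_def\<close>)
    show "A (R x) = R (A x)" if A: "bop A" and AB: "\<And>x. x \<in> X \<Longrightarrow> A (B x) = B (A x)" and x: "x \<in> X" for A x
    proof -
      note [simp] = bounded_opD(1)[OF A] bounded_op_vsub[OF A hilbert_self]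
      have "A (Z u) = Z (A u)" if "u \<in> X" for u using that by (simp add: Z_def AB)
      \<comment> \<open>\<open>A\<close> commutes with every \<open>Y n\<close>, so this one
        sequence converges both to \<open>W (A x)\<close> and, by continuity of \<open>A\<close>, to
        \<open>A (W x)\<close>.\<close>
      hence "conv (\<lambda>n. A (Y n x)) (W (A x))"
        using W[of "A x"] Ycomm[OF A] x by simp
      hence "A (W x) = W (A x)"
        using conv_unique[OF conv_bop[OF A W[OF x]]] by blast
      thus ?thesis using x by (simp add: R_def)
    qed
  qed
qed

end

section \<open>Transport of structure and the doubled space\<close>

lemma hilbertI:
  assumes "vzero H \<in> carrier H"
    and "\<And>x y. \<lbrakk>x \<in> carrier H; y \<in> carrier H\<rbrakk> \<Longrightarrow> vadd H x y \<in> carrier H"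
    and "\<And>a x. x \<in> carrier H \<Longrightarrow> vscale H a x \<in> carrier H"
    and "\<And>x y z. \<lbrakk>x \<in> carrier H; y \<in> carrier H; z \<in> carrier H\<rbrakk> \<Longrightarrow>
      vadd H (vadd H x y) z = vadd H x (vadd H y z)"
    and "\<And>x y. \<lbrakk>x \<in> carrier H; y \<in> carrier H\<rbrakk> \<Longrightarrow> vadd H x y = vadd H y x"
    and "\<And>x. x \<in> carrier H \<Longrightarrow> vadd H (vzero H) x = x"
    and "\<And>x. x \<in> carrier H \<Longrightarrow> \<exists>y\<in>carrier H. vadd H x y = vzero H"
    and "\<And>a x y. \<lbrakk>x \<in> carrier H; y \<in> carrier H\<rbrakk> \<Longrightarrow>
      vscale H a (vadd H x y) = vadd H (vscale H a x) (vscale H a y)"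
    and "\<And>a b x. x \<in> carrier H \<Longrightarrow> vscale H (a + b) x = vadd H (vscale H a x) (vscale H b x)"
    and "\<And>a b x. x \<in> carrier H \<Longrightarrow> vscale H (a * b) x = vscale H a (vscale H b x)"
    and "\<And>x. x \<in> carrier H \<Longrightarrow> vscale H 1 x = x"
    and "\<And>x y. \<lbrakk>x \<in> carrier H; y \<in> carrier H\<rbrakk> \<Longrightarrow> cinner H x y = cnj (cinner H y x)"
    and "\<And>x y z. \<lbrakk>x \<in> carrier H; y \<in> carrier H; z \<in> carrier H\<rbrakk> \<Longrightarrow>
      cinner H (vadd H x y) z = cinner H x z + cinner H y z"
    and "\<And>a x y. \<lbrakk>x \<in> carrier H; y \<in> carrier H\<rbrakk> \<Longrightarrow> cinner H (vscale H a x) y = a * cinner H x y"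
    and "\<And>x. x \<in> carrier H \<Longrightarrow> 0 \<le> Re (cinner H x x)"
    and "\<And>x. \<lbrakk>x \<in> carrier H; cinner H x x = 0\<rbrakk> \<Longrightarrow> x = vzero H"
    and "\<And>s :: nat \<Rightarrow> 'a. \<lbrakk>\<And>n. s n \<in> carrier H;
      \<forall>e>0. \<exists>N. \<forall>m\<ge>N. \<forall>n\<ge>N. hnorm H (vsub H (s m) (s n)) < e\<rbrakk> \<Longrightarrow>
      \<exists>l\<in>carrier H. \<forall>e>0. \<exists>N. \<forall>n\<ge>N. hnorm H (vsub H (s n) l) < e"
  shows "hilbert (H :: 'a chs)"
  unfolding hilbert_def hilbert_space_def
  apply (intro conjI)
                  apply (rule assms(1))
                 apply (use assms(2) in blast)
                apply (use assms(3) in blast)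
               apply (use assms(4) in blast)
              apply (use assms(5) in blast)
             apply (use assms(6) in blast)
            apply (use assms(7) in blast)
           apply (use assms(8) in blast)
          apply (use assms(9) in blast)
         apply (use assms(10) in blast)
        apply (use assms(11) in blast)
       apply (use assms(12) in blast)
      apply (use assms(13) in blast)
     apply (use assms(14) in blast)
    apply (use assms(15) in blast)
   apply (use assms(16) in blast)
  apply (intro allI impI assms(17))
   apply simp_all
  done

text \<open>Transport of structure along \<open>f\<close>, meant for \<open>g\<close> a left inverse
  of \<open>f\<close> on the carrier: arguments are pulled back through \<open>g\<close>, and
  \<open>f\<close> becomes a unitary onto the new space. This is how a space changes its
  type.\<close>

definition push :: "('a \<Rightarrow> 'b) \<Rightarrow> ('b \<Rightarrow> 'a) \<Rightarrow> 'a chs \<Rightarrow> 'b chs" where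
  "push f g H = \<lparr>carrier = f ` carrier H, vzero = f (vzero H),
     vadd = (\<lambda>x y. f (vadd H (g x) (g y))), vscale = (\<lambda>a x. f (vscale H a (g x))),
     cinner = (\<lambda>x y. cinner H (g x) (g y))\<rparr>"

lemma push_simps [simp]:
  "carrier (push f g H) = f ` carrier H" "vzero (push f g H) = f (vzero H)"
  "vadd (push f g H) x y = f (vadd H (g x) (g y))" "vscale (push f g H) a x = f (vscale H a (g x))"
  "cinner (push f g H) x y = cinner H (g x) (g y)" "hnorm (push f g H) x = hnorm H (g x)"
  by (simp_all add: push_def hnorm_def)

lemma hilbert_push:
  assumes H: "hilbert H" and gf: "\<And>x. x \<in> carrier H \<Longrightarrow> g (f x) = x"
  shows "hilbert (push f g H)"
proof -
  interpret hilbert H by fact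
  have sub: "vsub (push f g H) (f x) (f y) = f (vsub H x y)" if "x \<in> X" "y \<in> X" for x y
    using that by (simp add: vsub_def gf)
  show ?thesis
  proof (rule hilbertI, unfold push_simps)
    fix s :: "nat \<Rightarrow> 'b"
    assume s: "\<And>n. s n \<in> f ` X"
      and c: "\<forall>e>0. \<exists>N. \<forall>m\<ge>N. \<forall>n\<ge>N. \<parallel>g (vsub (push f g H) (s m) (s n))\<parallel> < e"
    have "\<forall>n. \<exists>y. y \<in> X \<and> s n = f y" using s by blast
    then obtain t where t: "\<And>n. t n \<in> X" "\<And>n. s n = f (t n)" by metis
    have "\<forall>e>0. \<exists>N. \<forall>m\<ge>N. \<forall>n\<ge>N. \<parallel>vsub H (t m) (t n)\<parallel> < e"
      using c by (simp add: t sub gf)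
    then obtain l where l: "l \<in> X" "\<forall>e>0. \<exists>N. \<forall>n\<ge>N. \<parallel>vsub H (t n) l\<parallel> < e"
      using complete[of t] t(1) by blast
    hence "\<forall>e>0. \<exists>N. \<forall>n\<ge>N. \<parallel>g (vsub (push f g H) (s n) (f l))\<parallel> < e"
      by (simp add: t sub gf)
    thus "\<exists>l\<in>f ` X. \<forall>e>0. \<exists>N. \<forall>n\<ge>N. \<parallel>g (vsub (push f g H) (s n) l)\<parallel> < e"
      using l(1) by blast
  next
    fix x assume "x \<in> f ` X"
    then obtain u where u: "u \<in> X" "x = f u" by blast
    obtain y where "y \<in> X" "u \<oplus> y = vzero H" using ex_neg[OF u(1)] by blast
    thus "\<exists>y\<in>f ` X. f (g x \<oplus> g y) = f (vzero H)" using u by (intro bexI[of _ "f y"]) (simp_all add: gf)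
  next
    fix x y assume "x \<in> f ` X" "y \<in> f ` X"
    thus "\<langle>g x, g y\<rangle> = cnj \<langle>g y, g x\<rangle>"
      by (intro inner_sym) (auto simp: gf)
  next
    fix x y assume "x \<in> f ` X" "y \<in> f ` X"
    thus "f (g x \<oplus> g y) = f (g y \<oplus> g x)"
      by (intro arg_cong[of _ _ f] add_commute) (auto simp: gf)
  next
    fix x assume "x \<in> f ` X" "\<langle>g x, g x\<rangle> = 0"
    thus "x = f (vzero H)"
      using inner_definite by (auto simp: gf)
  qed (auto simp: gf add_assoc scale_add_left scale_add_right scale_scale)
qed

lemma bounded_op_push:
  assumes H: "hilbert H" and gf: "\<And>x. x \<in> carrier H \<Longrightarrow> g (f x) = x" and T: "bounded_op H H T"
  shows "bounded_op (push f g H) (push f g H) (\<lambda>x. f (T (g x)))"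
proof -
  interpret hilbert H by fact
  note [simp] = bounded_opD[OF T]
  obtain C where "\<And>x. x \<in> X \<Longrightarrow> \<parallel>T x\<parallel> \<le> C * \<parallel>x\<parallel>"
    using bounded_op_bound[OF T H] by blast
  thus ?thesis by (intro bounded_opI[where C = C]) (auto simp: gf)
qed

lemma is_adjoint_push:
  assumes H: "hilbert H" and gf: "\<And>x. x \<in> carrier H \<Longrightarrow> g (f x) = x" and T: "is_adjoint H H T S"
  shows "is_adjoint (push f g H) (push f g H) (\<lambda>x. f (T (g x))) (\<lambda>x. f (S (g x)))"
  using bounded_op_push[OF H, where f = f and g = g] T
  by (auto simp: is_adjoint_def gf bounded_opD)

section \<open>The orthogonal direct sum of a space with itself\<close>

definition dbl :: "'a chs \<Rightarrow> ('a \<times> 'a) chs" where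
  "dbl H = \<lparr>carrier = carrier H \<times> carrier H, vzero = (vzero H, vzero H),
     vadd = (\<lambda>u v. (vadd H (fst u) (fst v), vadd H (snd u) (snd v))),
     vscale = (\<lambda>a u. (vscale H a (fst u), vscale H a (snd u))),
     cinner = (\<lambda>u v. cinner H (fst u) (fst v) + cinner H (snd u) (snd v))\<rparr>"

lemma dbl_simps [simp]:
  "carrier (dbl H) = carrier H \<times> carrier H" "vzero (dbl H) = (vzero H, vzero H)"
  "vadd (dbl H) u v = (vadd H (fst u) (fst v), vadd H (snd u) (snd v))"
  "vscale (dbl H) a u = (vscale H a (fst u), vscale H a (snd u))"
  "cinner (dbl H) u v = cinner H (fst u) (fst v) + cinner H (snd u) (snd v)"
  "vsub (dbl H) u v = (vsub H (fst u) (fst v), vsub H (snd u) (snd v))"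
  by (simp_all add: dbl_def vsub_def)

context hilbert
begin

lemma nrm_dbl: "\<lbrakk>x \<in> X; y \<in> X\<rbrakk> \<Longrightarrow> hnorm (dbl H) (x, y) = sqrt (\<parallel>x\<parallel>\<^sup>2 + \<parallel>y\<parallel>\<^sup>2)"
  by (simp add: hnorm_def)

lemma nrm_dbl_ge:
  assumes "x \<in> X" "y \<in> X"
  shows "\<parallel>x\<parallel> \<le> hnorm (dbl H) (x, y)" "\<parallel>y\<parallel> \<le> hnorm (dbl H) (x, y)"
  using assms by (auto simp: nrm_dbl intro!: real_le_rsqrt)

lemma nrm_dbl_le:
  assumes "x \<in> X" "y \<in> X"
  shows "hnorm (dbl H) (x, y) \<le> \<parallel>x\<parallel> + \<parallel>y\<parallel>"
  using assms by (auto simp: nrm_dbl intro!: sqrt_sum_squares_le_sum)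

lemma hilbert_dbl: "hilbert (dbl H)"
proof (rule hilbertI, unfold dbl_simps(1))
  fix s :: "nat \<Rightarrow> 'a \<times> 'a"
  assume s: "\<And>n. s n \<in> X \<times> X"
    and c: "\<forall>e>0. \<exists>N. \<forall>m\<ge>N. \<forall>n\<ge>N. hnorm (dbl H) (vsub (dbl H) (s m) (s n)) < e"
  define u v where "u n = fst (s n)" and "v n = snd (s n)" for n
  have uv: "u n \<in> X" "v n \<in> X" "s n = (u n, v n)" for n
    using s[of n] by (simp_all add: u_def v_def mem_Times_iff)
  have sub: "vsub (dbl H) (s m) (a, b) = (vsub H (u m) a, vsub H (v m) b)" for m a b
    by (simp add: uv)
  have le: "\<parallel>vsub H (u m) (u n)\<parallel> \<le> hnorm (dbl H) (vsub (dbl H) (s m) (s n))"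
    "\<parallel>vsub H (v m) (v n)\<parallel> \<le> hnorm (dbl H) (vsub (dbl H) (s m) (s n))" for m n
    unfolding uv(3)[of n] sub using uv by (simp_all only: nrm_dbl_ge vsub_closed)
  have "\<exists>l\<in>X. \<forall>e>0. \<exists>N. \<forall>n\<ge>N. \<parallel>vsub H (u n) l\<parallel> < e"
  proof (rule complete)
    fix e :: real assume "e > 0"
    then obtain N where N: "\<And>m n. \<lbrakk>m \<ge> N; n \<ge> N\<rbrakk> \<Longrightarrow> hnorm (dbl H) (vsub (dbl H) (s m) (s n)) < e"
      using c by blast
    show "\<exists>N. \<forall>m\<ge>N. \<forall>n\<ge>N. \<parallel>vsub H (u m) (u n)\<parallel> < e"
      by (intro exI[of _ N] allI impI le_less_trans[OF le(1) N])
  qed (rule uv)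
  then obtain l where l: "l \<in> X" "\<And>e. e > 0 \<Longrightarrow> \<exists>N. \<forall>n\<ge>N. \<parallel>vsub H (u n) l\<parallel> < e" by blast
  have "\<exists>l\<in>X. \<forall>e>0. \<exists>N. \<forall>n\<ge>N. \<parallel>vsub H (v n) l\<parallel> < e"
  proof (rule complete)
    fix e :: real assume "e > 0"
    then obtain N where N: "\<And>m n. \<lbrakk>m \<ge> N; n \<ge> N\<rbrakk> \<Longrightarrow> hnorm (dbl H) (vsub (dbl H) (s m) (s n)) < e"
      using c by blast
    show "\<exists>N. \<forall>m\<ge>N. \<forall>n\<ge>N. \<parallel>vsub H (v m) (v n)\<parallel> < e"
      by (intro exI[of _ N] allI impI le_less_trans[OF le(2) N])
  qed (rule uv)
  then obtain k where k: "k \<in> X" "\<And>e. e > 0 \<Longrightarrow> \<exists>N. \<forall>n\<ge>N. \<parallel>vsub H (v n) k\<parallel> < e" by blast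
  have "\<exists>N. \<forall>n\<ge>N. hnorm (dbl H) (vsub (dbl H) (s n) (l, k)) < e" if e: "e > 0" for e
  proof -
    obtain N N' where N: "\<And>n. n \<ge> N \<Longrightarrow> \<parallel>vsub H (u n) l\<parallel> < e / 2" "\<And>n. n \<ge> N' \<Longrightarrow> \<parallel>vsub H (v n) k\<parallel> < e / 2"
      using l(2)[OF half_gt_zero[OF e]] k(2)[OF half_gt_zero[OF e]] by blast
    have "hnorm (dbl H) (vsub (dbl H) (s n) (l, k)) < e" if "n \<ge> max N N'" for n
    proof -
      have "hnorm (dbl H) (vsub (dbl H) (s n) (l, k)) \<le> \<parallel>vsub H (u n) l\<parallel> + \<parallel>vsub H (v n) k\<parallel>"
        unfolding sub using uv l(1) k(1) by (intro nrm_dbl_le) simp_all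
      also have "\<dots> < e" using N[of n] that by fastforce
      finally show ?thesis .
    qed
    thus ?thesis by blast
  qed
  thus "\<exists>l\<in>X \<times> X. \<forall>e>0. \<exists>N. \<forall>n\<ge>N. hnorm (dbl H) (vsub (dbl H) (s n) l) < e"
    using l(1) k(1) by blast
next
  fix x assume x: "x \<in> X \<times> X" and z: "cinner (dbl H) x x = 0"
  have "Re \<langle>fst x, fst x\<rangle> + Re \<langle>snd x, snd x\<rangle> = 0" using arg_cong[OF z, of Re] by simp
  moreover have "0 \<le> Re \<langle>fst x, fst x\<rangle>" "0 \<le> Re \<langle>snd x, snd x\<rangle>" using x by auto
  ultimately have "Re \<langle>fst x, fst x\<rangle> = 0" "Re \<langle>snd x, snd x\<rangle> = 0" by linarith+
  hence "fst x = vzero H" "snd x = vzero H"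
    using x by (auto intro!: inner_definite simp: complex_eq_iff)
  thus "x = vzero (dbl H)" by (simp add: prod_eq_iff)
next
  fix x y assume "x \<in> X \<times> X" "y \<in> X \<times> X"
  thus "cinner (dbl H) x y = cnj (cinner (dbl H) y x)"
    using inner_sym[of "fst x" "fst y"] inner_sym[of "snd x" "snd y"] by (simp add: mem_Times_iff)
next
  fix x assume "x \<in> X \<times> X"
  thus "\<exists>y\<in>X \<times> X. vadd (dbl H) x y = vzero (dbl H)"
    using ex_neg[of "fst x"] ex_neg[of "snd x"] by (auto simp: mem_Times_iff)
next
  fix x y assume "x \<in> X \<times> X" "y \<in> X \<times> X"
  thus "vadd (dbl H) x y = vadd (dbl H) y x"
    using add_commute[of "fst x" "fst y"] add_commute[of "snd x" "snd y"] by (simp add: mem_Times_iff)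
qed (simp_all add: mem_Times_iff add_assoc scale_add_left scale_add_right scale_scale distrib_left)

lemma dbl_eqI:
  "\<lbrakk>x \<in> X; y \<in> X; x' \<in> X; y' \<in> X; \<And>z. z \<in> X \<Longrightarrow> \<langle>x, z\<rangle> = \<langle>x', z\<rangle>; \<And>z. z \<in> X \<Longrightarrow> \<langle>y, z\<rangle> = \<langle>y', z\<rangle>\<rbrakk>
    \<Longrightarrow> (x, y) = (x', y')"
  using vec_eqI by simp

text \<open>The natural multiples of a nonzero vector are distinct, so a nonzero space has an
  infinite carrier, which is equinumerous with its square. In the zero space the square is a single
  point, and \<open>fst\<close> is injective on it.\<close>

lemma ex_inj_dbl: "\<exists>f :: 'a \<times> 'a \<Rightarrow> 'a. inj_on f (X \<times> X)"
proof (cases "X = {vzero H}")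
  case True
  thus ?thesis by (intro exI[of _ fst]) (auto simp: inj_on_def)
next
  case False
  then obtain x where x: "x \<in> X" "x \<noteq> vzero H" using zero_closed by blast
  hence n0: "\<langle>x, x\<rangle> \<noteq> 0" using inner_definite by blast
  have "inj_on (\<lambda>n :: nat. of_nat n \<odot> x) UNIV"
  proof (rule inj_onI)
    fix m n :: nat assume "of_nat m \<odot> x = of_nat n \<odot> x"
    hence "\<langle>of_nat m \<odot> x, x\<rangle> = \<langle>of_nat n \<odot> x, x\<rangle>" by simp
    thus "m = n" using x n0 by simp
  qed
  hence "infinite (range (\<lambda>n :: nat. of_nat n \<odot> x))"
    using finite_imageD infinite_UNIV_nat by blast
  moreover have "range (\<lambda>n :: nat. of_nat n \<odot> x) \<subseteq> X" using x by auto
  ultimately have "infinite X" using finite_subset by blast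
  hence "(card_of (X \<times> X), card_of X) \<in> ordIso" by (rule card_of_Times_same_infinite)
  then obtain f where "bij_betw f (X \<times> X) X" using card_of_ordIso by blast
  thus ?thesis by (auto simp: bij_betw_def)
qed

end

section \<open>Dilating one operator\<close>

text \<open>The block matrix with rows (C, G) and (G, -C). It gives both \<open>Rot\<close> and
  \<open>Q\<close>, the latter with \<open>G\<close> multiplied by \<open>r\<close>.\<close>

definition sym2 :: "'a chs \<Rightarrow> ('a \<Rightarrow> 'a) \<Rightarrow> ('a \<Rightarrow> 'a) \<Rightarrow> 'a \<times> 'a \<Rightarrow> 'a \<times> 'a" where
  "sym2 H C G u = (vadd H (C (fst u)) (G (snd u)), vsub H (G (fst u)) (C (snd u)))"

definition diag :: "'a chs \<Rightarrow> real \<Rightarrow> 'a \<times> 'a \<Rightarrow> 'a \<times> 'a" where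
  "diag H c u = (fst u, vscale H (complex_of_real c) (snd u))"

text \<open>For invertible \<open>T\<close> and r > 0 this amounts to membership in
  \<open>class_C1r\<close>: the lower bound expresses \<parallel>r T^-1\<parallel> \<le> 1 without
  naming the inverse, which makes it easy to transport and to double.\<close>

definition annular :: "real \<Rightarrow> 'a chs \<Rightarrow> ('a \<Rightarrow> 'a) \<Rightarrow> bool" where
  "annular r H T \<longleftrightarrow> invertible_op H T \<and>
     (\<forall>x\<in>carrier H. r * hnorm H x \<le> hnorm H (T x) \<and> hnorm H (T x) \<le> hnorm H x)"

context hilbert
begin

lemma bounded_op_dblI:
  assumes F: "bounded_op L H F" and G: "bounded_op L H G"
  shows "bounded_op L (dbl H) (\<lambda>u. (F u, G u))"
proof -
  note [simp] = bounded_opD[OF F] bounded_opD[OF G]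
  obtain C D where C: "\<And>u. u \<in> carrier L \<Longrightarrow> \<parallel>F u\<parallel> \<le> C * hnorm L u"
    and D: "\<And>u. u \<in> carrier L \<Longrightarrow> \<parallel>G u\<parallel> \<le> D * hnorm L u"
    using F G unfolding bounded_op_def by metis
  show ?thesis
  proof (rule bounded_opI)
    fix u assume u: "u \<in> carrier L"
    show "hnorm (dbl H) (F u, G u) \<le> (C + D) * hnorm L u"
      using nrm_dbl_le[of "F u" "G u"] C[OF u] D[OF u] u by (simp add: distrib_right)
  qed simp_all
qed

lemma bounded_op_fst: "bounded_op (dbl H) H fst"
  and bounded_op_snd: "bounded_op (dbl H) H snd"
  using nrm_dbl_ge by (auto intro!: bounded_opI[where C = 1])

text \<open>Used to rewrite the output of \<open>bounded_op_comb\<close>, whose trivial coefficients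
  such as 1 or 0 disappear only on the carrier.\<close>

lemma bounded_op_cong: "(\<And>x. x \<in> carrier L \<Longrightarrow> T x = S x) \<Longrightarrow> hilbert L \<Longrightarrow> bounded_op L H T = bounded_op L H S"
  by (simp add: bounded_op_def hilbert.add_closed hilbert.scale_closed)

lemma bop_dbl_comp:
  assumes "bop A"
  shows "bounded_op (dbl H) H (\<lambda>u. A (fst u))" "bounded_op (dbl H) H (\<lambda>u. A (snd u))"
  using bounded_op_comp[OF hilbert_dbl hilbert_self bounded_op_fst assms]
    bounded_op_comp[OF hilbert_dbl hilbert_self bounded_op_snd assms] by simp_all

lemma bounded_op_sym2:
  assumes C: "bop C" and G: "bop G"
  shows "bounded_op (dbl H) (dbl H) (sym2 H C G)"
proof -
  note [simp] = bounded_opD(1)[OF C] bounded_opD(1)[OF G]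
  note cl = bop_dbl_comp[OF C] bop_dbl_comp[OF G]
  have 1: "bounded_op (dbl H) H (\<lambda>u. C (fst u) \<oplus> G (snd u))"
    using bounded_op_comb[OF cl(1) cl(4), of 1 1]
    by (rule iffD1[OF bounded_op_cong[OF _ hilbert_dbl], rotated]) auto
  have 2: "bounded_op (dbl H) H (\<lambda>u. vsub H (G (fst u)) (C (snd u)))"
    using bounded_op_comb[OF cl(3) cl(2), of 1 "-1"]
    by (rule iffD1[OF bounded_op_cong[OF _ hilbert_dbl], rotated]) (auto simp: vsub_def)
  show ?thesis
    using bounded_op_dblI[OF 1 2] by (simp add: sym2_def[abs_def])
qed

lemma is_adjoint_sym2:
  assumes "bop C" "bop G" "\<And>x y. \<lbrakk>x \<in> X; y \<in> X\<rbrakk> \<Longrightarrow> \<langle>C x, y\<rangle> = \<langle>x, C y\<rangle>"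
    "\<And>x y. \<lbrakk>x \<in> X; y \<in> X\<rbrakk> \<Longrightarrow> \<langle>G x, y\<rangle> = \<langle>x, G y\<rangle>"
  shows "is_adjoint (dbl H) (dbl H) (sym2 H C G) (sym2 H C G)"
  unfolding is_adjoint_def using bounded_op_sym2[OF assms(1,2)] assms
  by (auto simp: sym2_def bounded_opD)

text \<open>The off-diagonal entries of the square are CG - GC and its negative, which vanish; both
  diagonal entries are C^2 + G^2.\<close>

lemma sym2_sym2:
  assumes C: "bop C" and G: "bop G" and CG: "\<And>x. x \<in> X \<Longrightarrow> C (G x) = G (C x)"
    and B: "\<And>x. x \<in> X \<Longrightarrow> C (C x) \<oplus> G (G x) = B x" and u: "u \<in> X \<times> X"
  shows "sym2 H C G (sym2 H C G u) = map_prod B B u"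
proof -
  obtain x y where xy: "u = (x, y)" "x \<in> X" "y \<in> X" using u by blast
  note [simp] = bounded_opD[OF C] bounded_opD[OF G] bounded_op_vsub[OF C hilbert_self] bounded_op_vsub[OF G hilbert_self]
  have [simp]: "B v \<in> X" and B': "\<langle>B v, z\<rangle> = \<langle>C (C v), z\<rangle> + \<langle>G (G v), z\<rangle>" if "v \<in> X" "z \<in> X" for v z
    using that B[OF that(1), symmetric] by simp_all
  show ?thesis
    unfolding xy(1) sym2_def map_prod_simp using xy(2,3) B[of x, symmetric] B[of y, symmetric]
    by (intro dbl_eqI) (simp_all add: CG)
qed

lemma is_adjoint_map_prod:
  assumes A: "is_adjoint H H A B"
  shows "is_adjoint (dbl H) (dbl H) (map_prod A A) (map_prod B B)"
proof -
  have eq: "map_prod F F = (\<lambda>u. (F (fst u), F (snd u)))" for F :: "'a \<Rightarrow> 'a"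
    by (auto simp: fun_eq_iff)
  show ?thesis
    unfolding is_adjoint_def eq
    using is_adjointD(3)[OF A]
    by (auto intro!: bounded_op_dblI bop_dbl_comp is_adjointD(1)[OF A] is_adjointD(2)[OF A])
qed

lemma is_adjoint_diag: "is_adjoint (dbl H) (dbl H) (diag H c) (diag H c)"
proof -
  have "bounded_op (dbl H) H (\<lambda>u. complex_of_real c \<odot> snd u)"
    using bounded_op_comb[OF bounded_op_snd bounded_op_snd, of "complex_of_real c" 0]
    by (rule iffD1[OF bounded_op_cong[OF _ hilbert_dbl], rotated]) (auto intro!: vec_eqI)
  hence "bounded_op (dbl H) (dbl H) (diag H c)"
    using bounded_op_dblI[OF bounded_op_fst] by (simp add: diag_def[abs_def])
  thus ?thesis by (auto simp: is_adjoint_def diag_def)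
qed

lemma map_prod_sym2:
  assumes "bop A" "bop C" "bop G" "u \<in> X \<times> X"
    "\<And>x. x \<in> X \<Longrightarrow> A (C x) = C (A x)" "\<And>x. x \<in> X \<Longrightarrow> A (G x) = G (A x)"
  shows "map_prod A A (sym2 H C G u) = sym2 H C G (map_prod A A u)"
  using assms by (auto simp: sym2_def bounded_opD bounded_op_vsub hilbert_self)

lemma map_prod_diag:
  assumes "bop A" "u \<in> X \<times> X"
  shows "map_prod A A (diag H c u) = diag H c (map_prod A A u)"
  using assms by (auto simp: diag_def bounded_opD)

text \<open>A Q = Q P A Q = Q A P Q = Q A.\<close>

lemma commute_inverse:
  assumes "bop A" "bop Q" "\<And>x. x \<in> X \<Longrightarrow> A (P x) = P (A x)"
    "\<And>x. x \<in> X \<Longrightarrow> Q (P x) = x" "\<And>x. x \<in> X \<Longrightarrow> P (Q x) = x" "x \<in> X"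
  shows "A (Q x) = Q (A x)"
proof -
  have Qx: "Q x \<in> X" using assms(2,6) by (simp add: bounded_opD)
  have "A (Q x) = Q (P (A (Q x)))" using assms(4) bounded_opD(1)[OF assms(1) Qx] by simp
  also have "\<dots> = Q (A (P (Q x)))" by (simp only: assms(3)[OF Qx])
  also have "\<dots> = Q (A x)" using assms(5,6) by simp
  finally show ?thesis .
qed

text \<open>Take adjoints in T Q = 1. This identifies the adjoint of an inverse with the inverse of
  the adjoint.\<close>

lemma is_adjoint_inverse:
  assumes TS: "is_adjoint H H T S" and QR: "is_adjoint H H Q R"
    and "\<And>x. x \<in> X \<Longrightarrow> T (Q x) = x" "x \<in> X"
  shows "R (S x) = x"
proof (rule vec_eqI)
  fix z assume "z \<in> X"
  thus "\<langle>R (S x), z\<rangle> = \<langle>x, z\<rangle>"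
    using assms is_adjointD(3)[OF is_adjoint_sym[OF hilbert_self hilbert_self TS]]
      is_adjointD(3)[OF is_adjoint_sym[OF hilbert_self hilbert_self QR]]
      bounded_opD(1)[OF is_adjointD(2)[OF TS]] bounded_opD(1)[OF is_adjointD(1)[OF QR]] by simp
qed (use assms bounded_opD(1)[OF is_adjointD(2)[OF TS]] bounded_opD(1)[OF is_adjointD(2)[OF QR]] in simp_all)

text \<open>With \<open>B = T\<^sup>*T\<close>, the operators \<open>E = (B - r\<^sup>2)/(1 - r\<^sup>2)\<close> and \<open>F = 1 - E\<close> satisfy
  \<open>E + r\<^sup>2 F = B\<close>, so \<open>C = E\<^sup>1\<^sup>/\<^sup>2\<close> and \<open>G = F\<^sup>1\<^sup>/\<^sup>2\<close> give the isometry \<open>V x = (C x, G x)\<close>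
  that carries the form of \<open>B\<close> to that of \<open>diag(1, r\<^sup>2)\<close>.\<close>
lemma dilation_step:
  assumes r: "0 < r" "r < 1" and TS: "is_adjoint H H T S" and ann: "annular r H T"
  obtains M N V where
    "is_adjoint (dbl H) (dbl H) M N" "invertible_op (dbl H) M"
    "\<And>u v. \<lbrakk>u \<in> X \<times> X; v \<in> X \<times> X\<rbrakk> \<Longrightarrow>
      cinner (dbl H) (M u) (M v) = \<langle>fst u, fst v\<rangle> + complex_of_real (r\<^sup>2) * \<langle>snd u, snd v\<rangle>"
    "bounded_op H (dbl H) V"
    "\<And>x y. \<lbrakk>x \<in> X; y \<in> X\<rbrakk> \<Longrightarrow> cinner (dbl H) (V x) (V y) = \<langle>x, y\<rangle>"
    "\<And>x. x \<in> X \<Longrightarrow> V (T x) = M (V x)"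
    "\<And>A x u. \<lbrakk>bop A; \<And>x. x \<in> X \<Longrightarrow> A (T x) = T (A x); \<And>x. x \<in> X \<Longrightarrow> A (S x) = S (A x);
       x \<in> X; u \<in> X \<times> X\<rbrakk> \<Longrightarrow>
       V (A x) = map_prod A A (V x) \<and> map_prod A A (M u) = M (map_prod A A u) \<and>
       map_prod A A (N u) = N (map_prod A A u)"
proof -
  note T = is_adjointD(1)[OF TS] and S = is_adjointD(2)[OF TS]
  note [simp] = bounded_opD[OF T] bounded_opD[OF S]
  have SX: "\<langle>S x, y\<rangle> = \<langle>x, T y\<rangle>" if "x \<in> X" "y \<in> X" for x y
    using is_adjointD(3)[OF is_adjoint_sym[OF hilbert_self hilbert_self TS]] that by simp
  obtain Ti where Ti: "bop Ti" "\<And>x. x \<in> X \<Longrightarrow> Ti (T x) = x" "\<And>x. x \<in> X \<Longrightarrow> T (Ti x) = x"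
    using ann unfolding annular_def invertible_op_def by blast
  \<comment> \<open>\<open>Tis\<close> is the adjoint of the inverse of \<open>T\<close>,
    equivalently the inverse of \<open>S\<close>.\<close>
  obtain Tis where Tis: "is_adjoint H H Ti Tis"
    using adjoint_exists[OF hilbert_self hilbert_self Ti(1)] by blast
  note Tisb = is_adjointD(2)[OF Tis]
  note [simp] = bounded_opD[OF Ti(1)] bounded_opD[OF Tisb] Ti(2,3)
  have [simp]: "Tis (S x) = x" "S (Tis x) = x" if "x \<in> X" for x
    using is_adjoint_inverse[OF TS Tis] is_adjoint_inverse[OF Tis TS] that by simp_all
  define B where "B x = S (T x)" for x
  have B: "bop B" unfolding B_def by (rule bop_comp[OF T S])
  note [simp] = bounded_opD[OF B] bounded_op_vsub[OF B hilbert_self]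
  have Bin: "\<langle>B x, y\<rangle> = \<langle>T x, T y\<rangle>" if "x \<in> X" "y \<in> X" for x y
    using that by (simp add: B_def SX)
  have Bin': "\<langle>x, B y\<rangle> = \<langle>T x, T y\<rangle>" if "x \<in> X" "y \<in> X" for x y
    using that by (simp add: B_def is_adjointD(3)[OF TS, symmetric])
  have Ble: "Re \<langle>T x, T x\<rangle> \<le> Re \<langle>x, x\<rangle>" "r\<^sup>2 * Re \<langle>x, x\<rangle> \<le> Re \<langle>T x, T x\<rangle>" if "x \<in> X" for x
  proof -
    have "\<parallel>T x\<parallel>\<^sup>2 \<le> \<parallel>x\<parallel>\<^sup>2" "(r * \<parallel>x\<parallel>)\<^sup>2 \<le> \<parallel>T x\<parallel>\<^sup>2"
      using ann that r unfolding annular_def by (auto intro!: power_mono)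
    thus "Re \<langle>T x, T x\<rangle> \<le> Re \<langle>x, x\<rangle>" "r\<^sup>2 * Re \<langle>x, x\<rangle> \<le> Re \<langle>T x, T x\<rangle>"
      using that by (simp_all add: nrm_sq power_mult_distrib)
  qed
  define q where "q = 1 - r\<^sup>2"
  have q: "q > 0" using r by (simp add: q_def power_less_one_iff)
  \<comment> \<open>\<open>E\<close> and \<open>F\<close> are the unique solutions of E + F = 1 and
    E + r^2 F = B; \<open>q\<close> is the determinant 1 - r^2.\<close>
  define E where "E x = complex_of_real (1 / q) \<odot> B x \<oplus> complex_of_real (- r\<^sup>2 / q) \<odot> x" for x
  define F where "F x = complex_of_real (1 / q) \<odot> x \<oplus> complex_of_real (- 1 / q) \<odot> B x" for x
  have E: "bop E" unfolding E_def by (rule bounded_op_comb[OF B bop_id])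
  have F: "bop F" unfolding F_def by (rule bounded_op_comb[OF bop_id B])
  note [simp] = bounded_opD[OF E] bounded_opD[OF F]
  have AE: "A (E x) = E (A x)" "A (F x) = F (A x)"
    if "bop A" "\<And>x. x \<in> X \<Longrightarrow> A (B x) = B (A x)" "x \<in> X" for A x
    using that bounded_opD[OF that(1)] by (simp_all add: E_def F_def)
  obtain C where C: "bop C" "\<And>x y. \<lbrakk>x \<in> X; y \<in> X\<rbrakk> \<Longrightarrow> \<langle>C x, y\<rangle> = \<langle>x, C y\<rangle>"
    "\<And>x. x \<in> X \<Longrightarrow> C (C x) = E x"
    "\<And>A x. \<lbrakk>bop A; \<And>x. x \<in> X \<Longrightarrow> A (E x) = E (A x); x \<in> X\<rbrakk> \<Longrightarrow> A (C x) = C (A x)"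
  proof (rule sqrt_exists[OF E])
    fix x y assume "x \<in> X" "y \<in> X"
    thus "\<langle>E x, y\<rangle> = \<langle>x, E y\<rangle>" by (simp add: E_def Bin Bin')
  next
    fix x assume x: "x \<in> X"
    \<comment> \<open>Positivity of \<open>E\<close> is the lower bound r^2 \<le> B, and E \<le> 1
      is the upper bound B \<le> 1. For \<open>F\<close> the two bounds exchange roles.\<close>
    have *: "Re \<langle>E x, x\<rangle> = (Re \<langle>T x, T x\<rangle> - r\<^sup>2 * Re \<langle>x, x\<rangle>) / q"
      using x by (simp add: E_def Bin diff_divide_distrib)
    show "0 \<le> Re \<langle>E x, x\<rangle>" unfolding * using Ble[OF x] q by simp
    show "Re \<langle>E x, x\<rangle> \<le> Re \<langle>x, x\<rangle>"
      unfolding * using Ble[OF x] q by (simp add: divide_le_eq q_def algebra_simps)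
  qed blast
  obtain G where G: "bop G" "\<And>x y. \<lbrakk>x \<in> X; y \<in> X\<rbrakk> \<Longrightarrow> \<langle>G x, y\<rangle> = \<langle>x, G y\<rangle>"
    "\<And>x. x \<in> X \<Longrightarrow> G (G x) = F x"
    "\<And>A x. \<lbrakk>bop A; \<And>x. x \<in> X \<Longrightarrow> A (F x) = F (A x); x \<in> X\<rbrakk> \<Longrightarrow> A (G x) = G (A x)"
  proof (rule sqrt_exists[OF F])
    fix x y assume "x \<in> X" "y \<in> X"
    thus "\<langle>F x, y\<rangle> = \<langle>x, F y\<rangle>" by (simp add: F_def Bin Bin')
  next
    fix x assume x: "x \<in> X"
    have *: "Re \<langle>F x, x\<rangle> = (Re \<langle>x, x\<rangle> - Re \<langle>T x, T x\<rangle>) / q"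
      using x by (simp add: F_def Bin diff_divide_distrib)
    show "0 \<le> Re \<langle>F x, x\<rangle>" unfolding * using Ble[OF x] q by simp
    show "Re \<langle>F x, x\<rangle> \<le> Re \<langle>x, x\<rangle>"
      unfolding * using Ble[OF x] q by (simp add: divide_le_eq q_def algebra_simps)
  qed blast
  note [simp] = bounded_opD[OF C(1)] bounded_opD[OF G(1)]
  have ABC: "A (C x) = C (A x)" "A (G x) = G (A x)"
    if "bop A" "\<And>x. x \<in> X \<Longrightarrow> A (B x) = B (A x)" "x \<in> X" for A x
    using C(4)[OF that(1)] G(4)[OF that(1)] AE[OF that(1,2)] that(3) by simp_all
  have BE: "B x = complex_of_real q \<odot> E x \<oplus> complex_of_real (r\<^sup>2) \<odot> x" if "x \<in> X" for x
    using that q by (intro vec_eqI) (simp_all add: E_def Bin field_simps)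
  \<comment> \<open>B is an affine function of E = C^2. Knowing that \<open>C\<close> commutes with
    \<open>B\<close> lets \<open>ABC\<close> be used with \<open>A\<close> = \<open>C\<close>, and
    this is how \<open>C\<close> and \<open>G\<close> are seen to commute.\<close>
  have CB: "C (B x) = B (C x)" if "x \<in> X" for x
    using that C(3)[of "C x"] C(3)[of x] by (simp add: BE)
  have CG: "C (G x) = G (C x)" if "x \<in> X" for x
    using ABC(2)[OF C(1) CB that] .
  have GB: "G (B x) = B (G x)" if "x \<in> X" for x
    using ABC(2)[OF B refl that] by simp
  define rG where "rG x = complex_of_real r \<odot> G x" for x
  have rG: "bop rG"
    using bounded_op_comb[OF G(1) bounded_op_zero, of "complex_of_real r" 0]
    by (rule iffD1[OF bounded_op_cong[OF _ hilbert_self], rotated]) (auto simp: rG_def intro!: vec_eqI)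
  define Rot where "Rot = sym2 H C G"
  define Q where "Q = sym2 H C rG"
  have Rot: "is_adjoint (dbl H) (dbl H) Rot Rot"
    unfolding Rot_def by (rule is_adjoint_sym2[OF C(1) G(1) C(2) G(2)])
  have Q: "is_adjoint (dbl H) (dbl H) Q Q"
    unfolding Q_def by (rule is_adjoint_sym2[OF C(1) rG C(2)]) (auto simp: rG_def G(2))
  have Dg: "is_adjoint (dbl H) (dbl H) (diag H r) (diag H r)" by (rule is_adjoint_diag)
  have Tm: "is_adjoint (dbl H) (dbl H) (map_prod Tis Tis) (map_prod Ti Ti)"
    by (rule is_adjoint_map_prod[OF is_adjoint_sym[OF hilbert_self hilbert_self Tis]])
  note cl = bounded_opD(1)[OF is_adjointD(1)[OF Rot], unfolded dbl_simps(1)]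
    bounded_opD(1)[OF is_adjointD(1)[OF Q], unfolded dbl_simps(1)]
    bounded_opD(1)[OF is_adjointD(1)[OF is_adjoint_diag], unfolded dbl_simps(1)]
    bounded_opD(1)[OF is_adjointD(1)[OF Tm], unfolded dbl_simps(1)]
    bounded_opD(1)[OF is_adjointD(2)[OF Tm], unfolded dbl_simps(1)]
  have rq: "(complex_of_real r)\<^sup>2 = 1 - complex_of_real q" by (simp add: q_def)
  have CG1: "C (C x) \<oplus> G (G x) = x" if "x \<in> X" for x
    using that q by (intro vec_eqI) (simp_all add: C(3) G(3) E_def F_def Bin rq field_simps)
  have CGB: "C (C x) \<oplus> rG (rG x) = B x" if "x \<in> X" for x
    using that q by (intro vec_eqI) (simp_all add: C(3) G(3) rG_def E_def F_def Bin mult.assoc[symmetric] power2_eq_square[symmetric] rq field_simps)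
  have RR: "Rot (Rot u) = u" if "u \<in> X \<times> X" for u
    unfolding Rot_def using sym2_sym2[OF C(1) G(1) CG CG1 that] by (simp add: map_prod.id[unfolded id_def])
  have QQ: "Q (Q u) = map_prod B B u" if "u \<in> X \<times> X" for u
    unfolding Q_def by (rule sym2_sym2[OF C(1) rG _ CGB that]) (auto simp: rG_def CG)
  have BiB: "Ti (Tis (B x)) = x" "B (Ti (Tis x)) = x" if "x \<in> X" for x
    using that by (simp_all add: B_def)
  have CBi: "C (Ti (Tis x)) = Ti (Tis (C x))" and GBi: "G (Ti (Tis x)) = Ti (Tis (G x))" if "x \<in> X" for x
    using commute_inverse[OF C(1) bop_comp[OF Tisb Ti(1)] CB BiB that]
      commute_inverse[OF G(1) bop_comp[OF Tisb Ti(1)] GB BiB that] by simp_all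
  have mp: "map_prod (\<lambda>x. Ti (Tis x)) (\<lambda>x. Ti (Tis x)) u = map_prod Ti Ti (map_prod Tis Tis u)" for u
    by (cases u) simp
  \<comment> \<open>The composite of \<open>Ti\<close> and \<open>Tis\<close> is B^-1, which
    commutes with \<open>C\<close> and \<open>G\<close> and hence, doubled, with
    \<open>Q\<close>.\<close>
  have QBi: "Q (map_prod Ti Ti (map_prod Tis Tis (Q u))) = map_prod Ti Ti (map_prod Tis Tis (Q (Q u)))"
    if "u \<in> X \<times> X" for u
    using map_prod_sym2[OF bop_comp[OF Tisb Ti(1)] C(1) rG cl(2)[OF that]] CBi GBi
    by (simp add: Q_def rG_def mp)
  define M where "M u = Rot (map_prod Tis Tis (Q (diag H r u)))" for u
  define N where "N u = diag H r (Q (map_prod Ti Ti (Rot u)))" for u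
  \<comment> \<open>The inverse of \<open>M\<close>: since B^-1 S = Ti, inverting the factors in
    reverse order gives the formula for \<open>N\<close> with the last factor diag(1, r) replaced by
    diag(1, 1/r).\<close>
  define R where "R u = diag H (1 / r) (Q (map_prod Ti Ti (Rot u)))" for u
  have DD: "diag H r (diag H (1 / r) u) = u" "diag H (1 / r) (diag H r u) = u" if "u \<in> X \<times> X" for u
    using that r by (auto simp: diag_def simp flip: scale_scale of_real_mult)
  \<comment> \<open>All factors of \<open>M\<close> except the diagonal one cancel. Applying diag(1,
    1/r) afterwards yields R M = 1, and applying diag(1, r) yields N M = diag(1, r^2).\<close>
  have core: "Q (map_prod Ti Ti (Rot (M u))) = diag H r u" if "u \<in> X \<times> X" for u
  proof -
    have D: "diag H r u \<in> X \<times> X" using that by (rule cl)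
    have "Q (map_prod Ti Ti (Rot (M u))) = map_prod Ti Ti (map_prod Tis Tis (map_prod B B (diag H r u)))"
      using D by (simp add: M_def RR cl QBi QQ)
    also have "\<dots> = diag H r u" using D by (cases "diag H r u") (simp add: BiB)
    finally show ?thesis .
  qed
  note comp = is_adjoint_comp[OF hilbert_dbl hilbert_dbl hilbert_dbl]
  have MN: "is_adjoint (dbl H) (dbl H) M N"
    unfolding M_def N_def by (rule comp[OF comp[OF comp[OF Dg Q] Tm] Rot])
  have Rb: "bounded_op (dbl H) (dbl H) R"
    unfolding R_def
    by (rule is_adjointD(1)[OF comp[OF comp[OF comp[OF Rot is_adjoint_sym[OF hilbert_dbl hilbert_dbl Tm]] Q] is_adjoint_diag]])
  show thesis
  proof (rule that)
    show "is_adjoint (dbl H) (dbl H) M N" by (rule MN)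
    have "R (M u) = u" if "u \<in> X \<times> X" for u
      using that by (simp add: R_def core DD)
    moreover have "M (R u) = u" if u: "u \<in> X \<times> X" for u
    proof -
      have "M (R u) = Rot (map_prod Tis Tis (map_prod B B (map_prod Ti Ti (Rot u))))"
        using u by (simp add: M_def R_def DD QQ cl)
      also have "map_prod Tis Tis (map_prod B B (map_prod Ti Ti (Rot u))) = Rot u"
        using cl(1)[OF u] by (cases "Rot u") (simp add: B_def)
      finally show ?thesis using u by (simp add: RR)
    qed
    ultimately show "invertible_op (dbl H) M"
      using MN Rb unfolding invertible_op_def is_adjoint_def by auto
    show "cinner (dbl H) (M u) (M v) = \<langle>fst u, fst v\<rangle> + complex_of_real (r\<^sup>2) * \<langle>snd u, snd v\<rangle>"
      if u: "u \<in> X \<times> X" and v: "v \<in> X \<times> X" for u v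
    proof -
      have "cinner (dbl H) (M u) (M v) = cinner (dbl H) u (N (M v))"
        using is_adjointD(3)[OF MN, of u "M v"] bounded_opD(1)[OF is_adjointD(1)[OF MN], of v] u v by simp
      also have "N (M v) = diag H r (diag H r v)"
        using v by (simp add: N_def core)
      finally show ?thesis using u v by (auto simp: diag_def power2_eq_square)
    qed
    show "bounded_op H (dbl H) (\<lambda>x. (C x, G x))" by (rule bounded_op_dblI[OF C(1) G(1)])
    \<comment> \<open>By self-adjointness the left side is the inner product of \<open>x\<close>
      with (C^2 + G^2) y, and that operator is the identity.\<close>
    show "cinner (dbl H) (C x, G x) (C y, G y) = \<langle>x, y\<rangle>" if "x \<in> X" "y \<in> X" for x y
      using that arg_cong[OF CG1[OF that(2)], of "\<lambda>z. \<langle>x, z\<rangle>"] by (simp add: C(2) G(2))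
    show "(C (T x), G (T x)) = M (C x, G x)" if x: "x \<in> X" for x
    proof -
      \<comment> \<open>The first entry is (C^2 + r^2 G^2) x = B x; the second is r (G C - C G) x =
        0.\<close>
      have "Q (diag H r (C x, G x)) = (B x, vzero H)"
        using x CGB[OF x] by (simp add: Q_def sym2_def diag_def rG_def CG)
      hence "M (C x, G x) = Rot (T x, vzero H)"
        using x bounded_opD(3)[OF Tisb, of "vzero H" 0] by (simp add: M_def B_def scale_zero_left)
      also have "\<dots> = (C (T x), G (T x))"
        using x bounded_opD(3)[OF C(1), of "vzero H" 0] bounded_opD(3)[OF G(1), of "vzero H" 0]
        by (auto simp: Rot_def sym2_def scale_zero_left intro!: dbl_eqI)
      finally show ?thesis ..
    qed
    fix A x u
    assume A: "bop A" and AT: "\<And>x. x \<in> X \<Longrightarrow> A (T x) = T (A x)" and AS: "\<And>x. x \<in> X \<Longrightarrow> A (S x) = S (A x)"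
      and x: "x \<in> X" and u: "u \<in> X \<times> X"
    note [simp] = bounded_opD[OF A]
    have AB: "A (B x) = B (A x)" if "x \<in> X" for x using that by (simp add: B_def AT AS)
    have Ti': "A (Ti x) = Ti (A x)" if "x \<in> X" for x
      by (rule commute_inverse[where P = T, OF A Ti(1) AT]) (use that in simp_all)
    have Tis': "A (Tis x) = Tis (A x)" if "x \<in> X" for x
      by (rule commute_inverse[where P = S, OF A Tisb AS]) (use that in simp_all)
    have Rot': "map_prod A A (Rot u) = Rot (map_prod A A u)" if "u \<in> X \<times> X" for u
      unfolding Rot_def using that ABC[OF A AB] by (intro map_prod_sym2[OF A C(1) G(1)]) auto
    have Q': "map_prod A A (Q u) = Q (map_prod A A u)" if "u \<in> X \<times> X" for u
      unfolding Q_def using that ABC[OF A AB] by (intro map_prod_sym2[OF A C(1) rG]) (auto simp: rG_def)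
    have m: "map_prod A A (map_prod Ti Ti u) = map_prod Ti Ti (map_prod A A u)"
      "map_prod A A (map_prod Tis Tis u) = map_prod Tis Tis (map_prod A A u)" if "u \<in> X \<times> X" for u
      using that by (auto simp: Ti' Tis')
    show "(C (A x), G (A x)) = map_prod A A (C x, G x) \<and> map_prod A A (M u) = M (map_prod A A u) \<and>
       map_prod A A (N u) = N (map_prod A A u)"
      using x u ABC[OF A AB x] by (simp add: M_def N_def Rot' Q' m cl map_prod_diag[OF A])
  qed
qed

end

section \<open>Dilating the tuple\<close>

text \<open>The identity M* M = P0 + r^2 P1 written as an equality of sesquilinear forms, so that no
  adjoint has to be chosen or transported.\<close>

definition two_valued :: "real \<Rightarrow> 'a chs \<Rightarrow> ('a \<Rightarrow> 'a) \<Rightarrow> bool" where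
  "two_valued r H M \<longleftrightarrow> (\<exists>P0 P1. orth_proj H P0 \<and> orth_proj H P1 \<and>
     (\<forall>x\<in>carrier H. vadd H (P0 x) (P1 x) = x) \<and>
     (\<forall>x\<in>carrier H. \<forall>y\<in>carrier H. cinner H (M x) (M y) =
        cinner H (P0 x) y + complex_of_real (r\<^sup>2) * cinner H (P1 x) y))"

text \<open>The first \<open>k\<close> operators have already been dilated; \<open>S j\<close> is the adjoint of \<open>T j\<close>.\<close>
definition stage :: "real \<Rightarrow> nat \<Rightarrow> 'a chs \<Rightarrow> nat \<Rightarrow> (nat \<Rightarrow> 'a \<Rightarrow> 'a) \<Rightarrow> (nat \<Rightarrow> 'a \<Rightarrow> 'a) \<Rightarrow> bool" where
  "stage r k H d T S \<longleftrightarrow> hilbert H \<and>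
     (\<forall>j<d. is_adjoint H H (T j) (S j)) \<and>
     (\<forall>i<d. \<forall>j<d. \<forall>x\<in>carrier H. T i (T j x) = T j (T i x)) \<and>
     (\<forall>i<d. \<forall>j<d. i \<noteq> j \<longrightarrow> (\<forall>x\<in>carrier H. T i (S j x) = S j (T i x))) \<and>
     (\<forall>j<d. annular r H (T j)) \<and> (\<forall>j<k. two_valued r H (T j))"

text \<open>\<open>V\<close> carries the space isometrically onto an invariant subspace on which
  each \<open>M j\<close> acts as \<open>T j\<close>. Dilations in this form compose, unlike mere
  compressions.\<close>

definition extends :: "'a chs \<Rightarrow> nat \<Rightarrow> (nat \<Rightarrow> 'a \<Rightarrow> 'a) \<Rightarrow> 'b chs \<Rightarrow> (nat \<Rightarrow> 'b \<Rightarrow> 'b) \<Rightarrow> ('a \<Rightarrow> 'b) \<Rightarrow> bool" where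
  "extends H d T K M V \<longleftrightarrow> bounded_op H K V \<and>
     (\<forall>x\<in>carrier H. \<forall>y\<in>carrier H. cinner K (V x) (V y) = cinner H x y) \<and>
     (\<forall>j<d. \<forall>x\<in>carrier H. V (T j x) = M j (V x))"

lemma stageD:
  assumes "stage r k H d T S"
  shows "hilbert H" "j < d \<Longrightarrow> is_adjoint H H (T j) (S j)"
    "\<lbrakk>i < d; j < d; x \<in> carrier H\<rbrakk> \<Longrightarrow> T i (T j x) = T j (T i x)"
    "\<lbrakk>i < d; j < d; i \<noteq> j; x \<in> carrier H\<rbrakk> \<Longrightarrow> T i (S j x) = S j (T i x)"
    "j < d \<Longrightarrow> annular r H (T j)" "j < k \<Longrightarrow> two_valued r H (T j)"
  using assms unfolding stage_def by blast+

lemma extends_trans: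
  assumes H: "hilbert H" and K: "hilbert K"
    and V: "extends H d T K M V" and W: "extends K d M L N W"
  shows "extends H d T L N (\<lambda>x. W (V x))"
  using V W bounded_op_comp[OF H K] unfolding extends_def by (auto simp: bounded_opD(1))

section \<open>Transporting a stage along an injection\<close>

lemma annular_push:
  assumes H: "hilbert H" and gf: "\<And>x. x \<in> carrier H \<Longrightarrow> g (f x) = x" and T: "annular r H T"
  shows "annular r (push f g H) (\<lambda>x. f (T (g x)))"
proof -
  obtain R where b: "bounded_op H H T" "bounded_op H H R"
    and R: "\<And>x. x \<in> carrier H \<Longrightarrow> R (T x) = x \<and> T (R x) = x"
    using T unfolding annular_def invertible_op_def by blast
  have "invertible_op (push f g H) (\<lambda>x. f (T (g x)))"
    unfolding invertible_op_def
    using bounded_op_push[where f = f and g = g, OF H gf b(1)] bounded_op_push[where f = f and g = g, OF H gf b(2)] R bounded_opD(1)[OF b(1)] bounded_opD(1)[OF b(2)]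
    by (auto simp: gf intro!: exI[of _ "\<lambda>x. f (R (g x))"])
  thus ?thesis
    using T bounded_opD(1)[OF b(1)] by (auto simp: annular_def gf)
qed

lemma orth_proj_push:
  assumes H: "hilbert H" and gf: "\<And>x. x \<in> carrier H \<Longrightarrow> g (f x) = x" and P: "orth_proj H P"
  shows "orth_proj (push f g H) (\<lambda>x. f (P (g x)))"
  using P bounded_op_push[where f = f and g = g, OF H gf, of P] by (auto simp: orth_proj_def gf bounded_opD(1))

lemma two_valued_push:
  assumes H: "hilbert H" and gf: "\<And>x. x \<in> carrier H \<Longrightarrow> g (f x) = x" and M: "two_valued r H M"
    and Mb: "bounded_op H H M"
  shows "two_valued r (push f g H) (\<lambda>x. f (M (g x)))"
proof -
  obtain P0 P1 where P: "orth_proj H P0" "orth_proj H P1" "\<forall>x\<in>carrier H. vadd H (P0 x) (P1 x) = x"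
    "\<forall>x\<in>carrier H. \<forall>y\<in>carrier H. cinner H (M x) (M y) =
        cinner H (P0 x) y + complex_of_real (r\<^sup>2) * cinner H (P1 x) y"
    using M unfolding two_valued_def by blast
  have [simp]: "P0 x \<in> carrier H" "P1 x \<in> carrier H" "M x \<in> carrier H" if "x \<in> carrier H" for x
    using P(1,2) Mb that by (auto simp: orth_proj_def bounded_opD(1))
  show ?thesis
    unfolding two_valued_def
    using P(3,4)
    by (intro exI[of _ "\<lambda>x. f (P0 (g x))"] exI[of _ "\<lambda>x. f (P1 (g x))"] conjI orth_proj_push[where f = f and g = g, OF H gf] P(1,2))
      (auto simp: gf)
qed

lemma stage_push:
  assumes gf: "\<And>x. x \<in> carrier H \<Longrightarrow> g (f x) = x" and T: "stage r k H d T S" and k: "k \<le> d"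
  shows "stage r k (push f g H) d (\<lambda>j x. f (T j (g x))) (\<lambda>j x. f (S j (g x)))"
    and "extends H d T (push f g H) (\<lambda>j x. f (T j (g x))) f"
proof -
  note D = stageD[OF T]
  note H = D(1)
  interpret hilbert H by (rule H)
  have [simp]: "T j x \<in> X" "S j x \<in> X" if "j < d" "x \<in> X" for j x
    using is_adjointD(1,2)[OF D(2)[OF that(1)]] that(2) by (auto simp: bounded_opD(1))
  show "stage r k (push f g H) d (\<lambda>j x. f (T j (g x))) (\<lambda>j x. f (S j (g x)))"
    unfolding stage_def
  proof (intro conjI allI impI)
    show "hilbert (push f g H)" by (rule hilbert_push[where f = f and g = g, OF H gf])
  next
    fix j assume "j < d"
    thus "is_adjoint (push f g H) (push f g H) (\<lambda>x. f (T j (g x))) (\<lambda>x. f (S j (g x)))"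
      "annular r (push f g H) (\<lambda>x. f (T j (g x)))"
      by (auto intro: is_adjoint_push[where f = f and g = g, OF H gf] annular_push[where f = f and g = g, OF H gf] D)
  next
    fix j assume "j < k"
    thus "two_valued r (push f g H) (\<lambda>x. f (T j (g x)))"
      using k is_adjointD(1)[OF D(2)[of j]] by (auto intro: two_valued_push[where f = f and g = g, OF H gf] D)
  qed (auto simp: gf D(3,4))
  show "extends H d T (push f g H) (\<lambda>j x. f (T j (g x))) f"
    unfolding extends_def by (auto simp: gf intro!: bounded_opI[where C = 1])
qed

context hilbert
begin

lemma annular_dbl:
  assumes r: "0 \<le> r" and TS: "is_adjoint H H T S" and T: "annular r H T"
  shows "annular r (dbl H) (map_prod T T)"
proof -
  obtain R where R: "bop R" "\<And>x. x \<in> X \<Longrightarrow> R (T x) = x \<and> T (R x) = x"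
    using T unfolding annular_def invertible_op_def by blast
  obtain R' where R': "is_adjoint H H R R'"
    using adjoint_exists[OF hilbert_self hilbert_self R(1)] by blast
  have "invertible_op (dbl H) (map_prod T T)"
    unfolding invertible_op_def
    using is_adjointD(1)[OF is_adjoint_map_prod[OF TS]] is_adjointD(1)[OF is_adjoint_map_prod[OF R']] R(2)
    by (auto intro!: exI[of _ "map_prod R R"])
  moreover have "r * hnorm (dbl H) (x, y) \<le> hnorm (dbl H) (T x, T y) \<and> hnorm (dbl H) (T x, T y) \<le> hnorm (dbl H) (x, y)"
    if xy: "x \<in> X" "y \<in> X" for x y
  proof -
    have [simp]: "T x \<in> X" "T y \<in> X" using is_adjointD(1)[OF TS] xy by (auto simp: bounded_opD(1))
    have n: "r * \<parallel>x\<parallel> \<le> \<parallel>T x\<parallel>" "\<parallel>T x\<parallel> \<le> \<parallel>x\<parallel>" "r * \<parallel>y\<parallel> \<le> \<parallel>T y\<parallel>" "\<parallel>T y\<parallel> \<le> \<parallel>y\<parallel>"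
      using T xy unfolding annular_def by auto
    have "(r * \<parallel>x\<parallel>)\<^sup>2 + (r * \<parallel>y\<parallel>)\<^sup>2 \<le> \<parallel>T x\<parallel>\<^sup>2 + \<parallel>T y\<parallel>\<^sup>2" "\<parallel>T x\<parallel>\<^sup>2 + \<parallel>T y\<parallel>\<^sup>2 \<le> \<parallel>x\<parallel>\<^sup>2 + \<parallel>y\<parallel>\<^sup>2"
      using n r xy by (auto intro!: add_mono power_mono)
    moreover have "r * sqrt (\<parallel>x\<parallel>\<^sup>2 + \<parallel>y\<parallel>\<^sup>2) = sqrt ((r * \<parallel>x\<parallel>)\<^sup>2 + (r * \<parallel>y\<parallel>)\<^sup>2)"
      using r by (simp add: power_mult_distrib distrib_left[symmetric] real_sqrt_mult)
    ultimately show ?thesis using xy by (simp add: nrm_dbl)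
  qed
  ultimately show ?thesis unfolding annular_def by auto
qed

lemma orth_proj_dbl:
  assumes P: "orth_proj H P"
  shows "orth_proj (dbl H) (map_prod P P)"
proof -
  have "is_adjoint H H P P" using P by (auto simp: orth_proj_def is_adjoint_def)
  thus ?thesis
    using P is_adjoint_map_prod[of P P] by (auto simp: orth_proj_def is_adjoint_def)
qed

lemma two_valued_dbl:
  assumes "two_valued r H M"
  shows "two_valued r (dbl H) (map_prod M M)"
proof -
  obtain P0 P1 where P: "orth_proj H P0" "orth_proj H P1" "\<forall>x\<in>X. P0 x \<oplus> P1 x = x"
    "\<forall>x\<in>X. \<forall>y\<in>X. \<langle>M x, M y\<rangle> = \<langle>P0 x, y\<rangle> + complex_of_real (r\<^sup>2) * \<langle>P1 x, y\<rangle>"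
    using assms unfolding two_valued_def by blast
  show ?thesis
    unfolding two_valued_def using P(3,4)
    by (intro exI[of _ "map_prod P0 P0"] exI[of _ "map_prod P1 P1"] conjI orth_proj_dbl P(1,2))
      (auto simp: distrib_left)
qed

text \<open>The two projections are those onto the summands of the doubled space.\<close>

lemma two_valued_dilation:
  assumes "\<And>u v. \<lbrakk>u \<in> X \<times> X; v \<in> X \<times> X\<rbrakk> \<Longrightarrow>
      cinner (dbl H) (M u) (M v) = \<langle>fst u, fst v\<rangle> + complex_of_real (r\<^sup>2) * \<langle>snd u, snd v\<rangle>"
  shows "two_valued r (dbl H) M"
proof -
  have M': "\<forall>u\<in>carrier (dbl H). \<forall>v\<in>carrier (dbl H). cinner (dbl H) (M u) (M v) =
      cinner (dbl H) (fst u, vzero H) v + complex_of_real (r\<^sup>2) * cinner (dbl H) (vzero H, snd u) v"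
    using assms by (auto simp del: dbl_simps(5)) (auto)
  show ?thesis
    unfolding two_valued_def
    by (rule exI[of _ "\<lambda>u. (fst u, vzero H)"], rule exI[of _ "\<lambda>u. (vzero H, snd u)"])
      (use M' in \<open>auto simp: orth_proj_def
         intro!: bounded_op_dblI bounded_op_fst bounded_op_snd bounded_op_zero\<close>)
qed

text \<open>With p and q the squared norms of the two components of \<open>u\<close>, the claim is
  r^2 (p + q) \<le> p + r^2 q \<le> p + q. The dilated operator thus stays eligible for later
  stages.\<close>

lemma annular_dilation:
  assumes r: "0 \<le> r" "r \<le> 1" and inv: "invertible_op (dbl H) M"
    and M: "\<And>u v. \<lbrakk>u \<in> X \<times> X; v \<in> X \<times> X\<rbrakk> \<Longrightarrow>
      cinner (dbl H) (M u) (M v) = \<langle>fst u, fst v\<rangle> + complex_of_real (r\<^sup>2) * \<langle>snd u, snd v\<rangle>"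
  shows "annular r (dbl H) M"
proof -
  have "r * hnorm (dbl H) u \<le> hnorm (dbl H) (M u) \<and> hnorm (dbl H) (M u) \<le> hnorm (dbl H) u" if u: "u \<in> X \<times> X" for u
  proof -
    define p q where "p = Re \<langle>fst u, fst u\<rangle>" and "q = Re \<langle>snd u, snd u\<rangle>"
    have pq: "0 \<le> p" "0 \<le> q" using u by (auto simp: p_def q_def)
    have r2: "r\<^sup>2 \<le> 1" using r by (simp add: power_le_one)
    have "hnorm (dbl H) (M u) = sqrt (p + r\<^sup>2 * q)" "hnorm (dbl H) u = sqrt (p + q)"
      using M[OF u u] by (simp_all add: hnorm_def p_def q_def)
    moreover have "r * sqrt (p + q) = sqrt (r\<^sup>2 * (p + q))"
      using r by (simp add: real_sqrt_mult)
    moreover have "r\<^sup>2 * p \<le> p" "r\<^sup>2 * q \<le> q"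
      using pq r2 by (simp_all add: mult_left_le_one_le)
    ultimately show ?thesis by (simp add: distrib_left)
  qed
  thus ?thesis using inv by (simp add: annular_def)
qed

end

text \<open>Operator \<open>k\<close> is dilated while the others are doubled. Doubling preserves
  all their properties, and by double commutation each of them meets the conditions under which its
  double commutes with the dilation and its adjoint.\<close>

lemma stage_step:
  assumes r: "0 < r" "r < 1" and st: "stage r k H d T S" and k: "k < d"
  shows "\<exists>M N V. stage r (Suc k) (dbl H) d M N \<and> extends H d T (dbl H) M V"
proof -
  note D = stageD[OF st]
  interpret hilbert H by (rule D)
  note Tb = is_adjointD(1)[OF D(2)] and Sb = is_adjointD(2)[OF D(2)]
  note cl = bounded_opD(1)[OF Tb] bounded_opD(1)[OF Sb]
  \<comment> \<open>Obtained from T j T i = T i T j by taking adjoints; it is needed to treat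
    \<open>S j\<close> as an operator commuting with \<open>S k\<close>.\<close>
  have SS: "S i (S j x) = S j (S i x)" if "i < d" "j < d" "x \<in> X" for i j x
    using adjoint_unique[OF hilbert_self hilbert_self
        is_adjoint_comp[OF hilbert_self hilbert_self hilbert_self D(2)[OF that(1)] D(2)[OF that(2)]], of "\<lambda>y. S j (S i y)" x]
      is_adjoint_comp[OF hilbert_self hilbert_self hilbert_self D(2)[OF that(2)] D(2)[OF that(1)]]
      that D(3) cl by (simp add: is_adjoint_def bounded_op_def)
  obtain M N V where MN: "is_adjoint (dbl H) (dbl H) M N" and inv: "invertible_op (dbl H) M"
    and MM: "\<And>u v. \<lbrakk>u \<in> X \<times> X; v \<in> X \<times> X\<rbrakk> \<Longrightarrow>
      cinner (dbl H) (M u) (M v) = \<langle>fst u, fst v\<rangle> + complex_of_real (r\<^sup>2) * \<langle>snd u, snd v\<rangle>"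
    and V: "bounded_op H (dbl H) V" "\<And>x y. \<lbrakk>x \<in> X; y \<in> X\<rbrakk> \<Longrightarrow> cinner (dbl H) (V x) (V y) = \<langle>x, y\<rangle>"
      "\<And>x. x \<in> X \<Longrightarrow> V (T k x) = M (V x)"
    and comm: "\<And>A x u. \<lbrakk>bop A; \<And>x. x \<in> X \<Longrightarrow> A (T k x) = T k (A x);
       \<And>x. x \<in> X \<Longrightarrow> A (S k x) = S k (A x); x \<in> X; u \<in> X \<times> X\<rbrakk> \<Longrightarrow>
       V (A x) = map_prod A A (V x) \<and> map_prod A A (M u) = M (map_prod A A u) \<and>
       map_prod A A (N u) = N (map_prod A A u)"
    using dilation_step[OF r D(2)[OF k] D(5)[OF k]] by blast
  \<comment> \<open>\<open>comm\<close> speaks of a vector \<open>x\<close> and a pair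
    \<open>u\<close> together; zero vectors fill the slot that a particular use does not
    concern.\<close>
  have z: "(vzero H, vzero H) \<in> X \<times> X" by simp
  have cT: "V (T j x) = map_prod (T j) (T j) (V x)"
    "map_prod (T j) (T j) (M u) = M (map_prod (T j) (T j) u)"
    "map_prod (T j) (T j) (N u) = N (map_prod (T j) (T j) u)"
    if "j < d" "j \<noteq> k" "x \<in> X" "u \<in> X \<times> X" for j x u
    using comm[OF Tb[OF that(1)] _ _ that(3,4)] D(3,4) k that by simp_all
  have cS: "map_prod (S j) (S j) (M u) = M (map_prod (S j) (S j) u)"
    if "j < d" "j \<noteq> k" "u \<in> X \<times> X" for j u
    using comm[OF Sb[OF that(1)] _ _ zero_closed that(3)] D(4)[OF k that(1)] SS k that by simp
  define M' where "M' j = (if j = k then M else map_prod (T j) (T j))" for j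
  define N' where "N' j = (if j = k then N else map_prod (S j) (S j))" for j
  have "stage r (Suc k) (dbl H) d M' N'"
    unfolding stage_def
  proof (intro conjI allI impI ballI)
    show "hilbert (dbl H)" by (rule hilbert_dbl)
  next
    fix j assume j: "j < d"
    show "is_adjoint (dbl H) (dbl H) (M' j) (N' j)"
      using MN is_adjoint_map_prod[OF D(2)[OF j]] by (simp add: M'_def N'_def)
    show "annular r (dbl H) (M' j)"
      using annular_dilation[OF _ _ inv MM] annular_dbl[OF _ D(2)[OF j] D(5)[OF j]] r by (simp add: M'_def)
  next
    fix j assume "j < Suc k"
    thus "two_valued r (dbl H) (M' j)"
      using two_valued_dilation[OF MM] two_valued_dbl[OF D(6)[of j]] by (simp add: M'_def)
  next
    fix i j u assume ij: "i < d" "j < d" and u: "u \<in> carrier (dbl H)"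
    have "map_prod (T i) (T i) (map_prod (T j) (T j) u) = map_prod (T j) (T j) (map_prod (T i) (T i) u)"
      using u D(3)[OF ij] by (cases u) simp
    thus "M' i (M' j u) = M' j (M' i u)"
      using cT(2)[OF ij(1) _ zero_closed, of u] cT(2)[OF ij(2) _ zero_closed, of u] u by (auto simp: M'_def)
  next
    fix i j u assume ij: "i < d" "j < d" "i \<noteq> j" and u: "u \<in> carrier (dbl H)"
    have "map_prod (T i) (T i) (map_prod (S j) (S j) u) = map_prod (S j) (S j) (map_prod (T i) (T i) u)"
      using u D(4)[OF ij] by (cases u) simp
    thus "M' i (N' j u) = N' j (M' i u)"
      using cT(3)[OF ij(1) _ zero_closed, of u] cS[OF ij(2) _, of u] u ij(3) by (auto simp: M'_def N'_def)
  qed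
  moreover have "extends H d T (dbl H) M' V"
    unfolding extends_def using V cT(1)[OF _ _ _ z] by (auto simp: M'_def)
  ultimately show ?thesis by blast
qed

text \<open>The spaces before and after must share the type \<open>'a\<close> for the induction
  hypothesis to apply. Hence each doubled space is at once injected back into \<open>'a\<close> and
  its structure pushed along that injection.\<close>

lemma stage_iterate:
  fixes H :: "'a chs"
  assumes r: "0 < r" "r < 1" and st: "stage r 0 H d T S" and "k \<le> d"
  shows "\<exists>(K :: 'a chs) M N V. stage r k K d M N \<and> extends H d T K M V"
  using \<open>k \<le> d\<close>
proof (induction k)
  case 0
  have "extends H d T H T (\<lambda>x. x)"
    using hilbert.bop_id[OF stageD(1)[OF st]] by (simp add: extends_def)
  thus ?case using st by blast
next
  case (Suc k)
  then obtain K :: "'a chs" and M N V where K: "stage r k K d M N" "extends H d T K M V" by auto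
  obtain M' N' V' where K': "stage r (Suc k) (dbl K) d M' N'" "extends K d M (dbl K) M' V'"
    using stage_step[OF r K(1)] Suc.prems by (auto simp: Suc_le_eq)
  interpret K: hilbert K by (rule stageD(1)[OF K(1)])
  obtain f :: "'a \<times> 'a \<Rightarrow> 'a" where f: "inj_on f (K.X \<times> K.X)" using K.ex_inj_dbl by blast
  define g where "g = inv_into (K.X \<times> K.X) f"
  have gf: "g (f u) = u" if "u \<in> carrier (dbl K)" for u
    using f that by (simp add: g_def)
  note P = stage_push[where f = f and g = g, OF gf K'(1) Suc.prems]
  note H = stageD(1)[OF st] stageD(1)[OF K(1)] stageD(1)[OF K'(1)]
  show ?case
    using P(1) extends_trans[OF H(1,3) extends_trans[OF H(1,2) K(2) K'(2)] P(2)] by blast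
qed

section \<open>Return to the notions of the statement, and integer powers\<close>

lemma class_calC1rI:
  assumes K: "hilbert K" and M: "bounded_op K K M" and tv: "two_valued r K M"
  shows "class_calC1r r K M"
proof -
  interpret hilbert K by (rule K)
  obtain P0 P1 where P: "orth_proj K P0" "orth_proj K P1" "\<forall>x\<in>X. vadd K (P0 x) (P1 x) = x"
    "\<forall>x\<in>X. \<forall>y\<in>X. cinner K (M x) (M y) = cinner K (P0 x) y + complex_of_real (r\<^sup>2) * cinner K (P1 x) y"
    using tv unfolding two_valued_def by blast
  have ad: "is_adjoint K K (adj K K M) M"
    by (rule is_adjoint_sym[OF K K adj_is_adjoint[OF K K M]])
  have [simp]: "P0 x \<in> X" "P1 x \<in> X" "M x \<in> X" "adj K K M x \<in> X" if "x \<in> X" for x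
    using P(1,2) M is_adjointD(1)[OF ad] that by (auto simp: orth_proj_def bounded_opD(1))
  have "adj K K M (M x) = vadd K (P0 x) (vscale K (complex_of_real (r\<^sup>2)) (P1 x))" if "x \<in> X" for x
    using that P(4) by (intro vec_eqI) (simp_all add: is_adjointD(3)[OF ad])
  thus ?thesis unfolding class_calC1r_def using M P(1-3) by blast
qed

lemma inv_opD:
  assumes "invertible_op H T"
  shows "bounded_op H H (inv_op H T)" "x \<in> carrier H \<Longrightarrow> inv_op H T (T x) = x"
    "x \<in> carrier H \<Longrightarrow> T (inv_op H T x) = x"
  using someI_ex[of "\<lambda>S. bounded_op H H S \<and> (\<forall>x\<in>carrier H. S (T x) = x \<and> T (S x) = x)"] assms
  unfolding inv_op_def invertible_op_def by blast+

text \<open>The lower bound is the contractivity of r T^-1 evaluated at the vector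
  \<open>T x\<close>.\<close>

lemma annularI:
  assumes H: "hilbert H" and r: "0 < r" and T: "class_C1r r H T"
  shows "annular r H T"
proof -
  interpret hilbert H by (rule H)
  have inv: "invertible_op H T" and le: "\<And>x. x \<in> X \<Longrightarrow> hnorm H (T x) \<le> hnorm H x"
    and ge: "\<And>x. x \<in> X \<Longrightarrow> hnorm H (vscale H (complex_of_real r) (inv_op H T x)) \<le> hnorm H x"
    using T by (auto simp: class_C1r_def opnorm_le_def)
  note D = inv_opD[OF inv]
  have TX: "T x \<in> X" if "x \<in> X" for x using inv that by (auto simp: invertible_op_def bounded_opD(1))
  have "r * hnorm H x \<le> hnorm H (T x)" if "x \<in> X" for x
    using ge[OF TX[OF that]] D(2)[OF that] that r by simp
  thus ?thesis using inv le by (simp add: annular_def)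
qed

text \<open>Negative powers reduce to V T^-1 = M^-1 M V T^-1 = M^-1 V T T^-1 = M^-1 V. Membership in
  the carrier is proved along with the identity because each further factor is applied to the
  result.\<close>

lemma zpow_intertwine:
  assumes V: "\<And>x. x \<in> carrier H \<Longrightarrow> V x \<in> carrier K" "\<And>x. x \<in> carrier H \<Longrightarrow> V (T x) = M (V x)"
    and T: "invertible_op H T" and M: "invertible_op K M" and x: "x \<in> carrier H"
  shows "zpow H T n x \<in> carrier H \<and> V (zpow H T n x) = zpow K M n (V x)"
proof -
  note DT = inv_opD[OF T] and DM = inv_opD[OF M]
  have TX: "T x \<in> carrier H" if "x \<in> carrier H" for x using T that by (auto simp: invertible_op_def bounded_opD(1))
  have iV: "V (inv_op H T x) = inv_op K M (V x)" if x: "x \<in> carrier H" for x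
  proof -
    have ix: "inv_op H T x \<in> carrier H" by (rule bounded_opD(1)[OF DT(1) x])
    have "V (inv_op H T x) = inv_op K M (M (V (inv_op H T x)))" using DM(2) V(1)[OF ix] by simp
    also have "\<dots> = inv_op K M (V x)" using V(2)[OF ix] DT(3)[OF x] by simp
    finally show ?thesis .
  qed
  have it: "(A ^^ m) x \<in> carrier H \<and> V ((A ^^ m) x) = (B ^^ m) (V x)"
    if "\<And>x. x \<in> carrier H \<Longrightarrow> A x \<in> carrier H" "\<And>x. x \<in> carrier H \<Longrightarrow> V (A x) = B (V x)" for A B m
    by (induction m) (simp_all add: x that)
  show ?thesis
    unfolding zpow_def using it[of T M, OF TX V(2)] it[of "inv_op H T" "inv_op K M", OF bounded_opD(1)[OF DT(1)] iV] by simp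
qed

text \<open>Both products compose their factors in the same order, so \<open>V\<close> passes them
  one at a time; the induction runs over an arbitrary list of indices below
  \<open>d\<close>.\<close>

lemma multi_pow_intertwine:
  assumes V: "\<And>x. x \<in> carrier H \<Longrightarrow> V x \<in> carrier K"
    and ext: "\<And>j x. \<lbrakk>j < d; x \<in> carrier H\<rbrakk> \<Longrightarrow> V (T j x) = M j (V x)"
    and T: "\<And>j. j < d \<Longrightarrow> invertible_op H (T j)" and M: "\<And>j. j < d \<Longrightarrow> invertible_op K (M j)"
    and x: "x \<in> carrier H"
  shows "multi_pow H d T n x \<in> carrier H \<and> V (multi_pow H d T n x) = multi_pow K d M n (V x)"
proof -
  have "foldr (\<lambda>j acc. zpow H (T j) (n j) \<circ> acc) js id x \<in> carrier H \<and>
     V (foldr (\<lambda>j acc. zpow H (T j) (n j) \<circ> acc) js id x) = foldr (\<lambda>j acc. zpow K (M j) (n j) \<circ> acc) js id (V x)"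
    if "set js \<subseteq> {..<d}" for js
    using that
  proof (induction js)
    case (Cons j js)
    hence j: "j < d" by simp
    show ?case
      using zpow_intertwine[of H V K "T j" "M j", OF V ext[OF j] T[OF j] M[OF j]] Cons by simp
  qed (simp add: x)
  thus ?thesis unfolding multi_pow_def by (simp add: atLeast0LessThan)
qed

theorem theorem2p5:
  fixes r :: real and H :: "'a chs" and d :: nat and T :: "nat \<Rightarrow> 'a \<Rightarrow> 'a"
  assumes "0 < r" and "r < 1"
    and "hilbert_space H"
    and "\<forall>j<d. class_C1r r H (T j)"
    and "doubly_commuting H d T"
    and "\<forall>j<d. finite (op_spectrum H (op_sqrt H (\<lambda>x. adj H H (T j) (T j x)))) \<and>
               op_spectrum H (op_sqrt H (\<lambda>x. adj H H (T j) (T j x)))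
                 \<subseteq> complex_of_real ` {r<..<1}"
  shows "\<exists>(K :: 'a set chs) V M.
           hilbert_space K \<and> isometry_op H K V \<and>
           (\<forall>j<d. class_calC1r r K (M j) \<and> invertible_op K (M j)) \<and>
           doubly_commuting K d M \<and>
           (\<forall>n :: nat \<Rightarrow> int. \<forall>x\<in>carrier H.
              multi_pow H d T n x = adj H K V (multi_pow K d M n (V x)))"
proof -
  have H: "hilbert H" using assms(3) by unfold_locales
  interpret H: hilbert H by (rule H)
  have Tinv: "invertible_op H (T j)" if "j < d" for j using assms(4) that by (simp add: class_C1r_def)
  have Tb: "bounded_op H H (T j)" if "j < d" for j using Tinv[OF that] by (simp add: invertible_op_def)
  have "stage r 0 H d T (\<lambda>j. adj H H (T j))"
    unfolding stage_def
    using H adj_is_adjoint[OF H H Tb] assms(5) annularI[OF H assms(1)] assms(4)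
    by (auto simp: doubly_commuting_def)
  then obtain L :: "'a chs" and A B W where L: "stage r d L d A B" "extends H d T L A W"
    using stage_iterate[OF assms(1,2) _ order_refl] by blast
  \<comment> \<open>The space required has vectors of type \<open>'a set\<close>, while
    \<open>L\<close> has vectors of type \<open>'a\<close>; singletons embed the one in the other,
    with \<open>the_elem\<close> as left inverse.\<close>
  define f :: "'a \<Rightarrow> 'a set" where "f x = {x}" for x
  define K where "K = push f the_elem L"
  define M where "M j x = f (A j (the_elem x))" for j x
  define N where "N j x = f (B j (the_elem x))" for j x
  define V where "V x = f (W x)" for x
  have gf: "the_elem (f x) = x" for x by (simp add: f_def)
  have KM: "stage r d K d M N" and ext: "extends H d T K M V"
    using stage_push[where f = f and g = the_elem, OF gf L(1) order_refl] extends_trans[OF H stageD(1)[OF L(1)] L(2)]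
    unfolding K_def M_def N_def V_def by blast+
  note D = stageD[OF KM]
  interpret K: hilbert K by (rule D)
  have Vb: "bounded_op H K V" and Vi: "\<And>x y. \<lbrakk>x \<in> H.X; y \<in> H.X\<rbrakk> \<Longrightarrow> cinner K (V x) (V y) = cinner H x y"
    and VT: "\<And>j x. \<lbrakk>j < d; x \<in> H.X\<rbrakk> \<Longrightarrow> V (T j x) = M j (V x)"
    using ext by (auto simp: extends_def)
  have Minv: "invertible_op K (M j)" if "j < d" for j using D(5)[OF that] by (simp add: annular_def)
  note Vadj = adj_is_adjoint[OF H D(1) Vb]
  \<comment> \<open>V* V = 1, the polarised form of the isometry property. Together with the
    intertwining of powers it yields the compression formula.\<close>
  have VV: "adj H K V (V x) = x" if "x \<in> H.X" for x
  proof (rule H.vec_eqI)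
    have VX: "V y \<in> K.X" if "y \<in> H.X" for y using Vb that by (rule bounded_opD(1))
    show "adj H K V (V x) \<in> H.X" using bounded_opD(1)[OF is_adjointD(2)[OF Vadj]] VX that by simp
    show "cinner H (adj H K V (V x)) z = cinner H x z" if "z \<in> H.X" for z
      using is_adjointD(3)[OF is_adjoint_sym[OF H D(1) Vadj] VX[OF \<open>x \<in> H.X\<close>] that] Vi that \<open>x \<in> H.X\<close> by simp
  qed (rule that)
  have "isometry_op H K V"
    using Vb Vi by (simp add: isometry_op_def hnorm_def)
  moreover have "class_calC1r r K (M j) \<and> invertible_op K (M j)" if "j < d" for j
    using class_calC1rI[OF D(1) is_adjointD(1)[OF D(2)] D(6)] Minv that by blast
  moreover have "doubly_commuting K d M"
    unfolding doubly_commuting_def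
    using D(3,4) adj_eq[OF D(1) D(1) D(2)] bounded_opD(1)[OF is_adjointD(1)[OF D(2)]] by simp
  moreover have "multi_pow H d T n x = adj H K V (multi_pow K d M n (V x))" if "x \<in> H.X" for n x
    using multi_pow_intertwine[of H V K d T M, OF bounded_opD(1)[OF Vb] VT Tinv Minv that, of n] VV by metis
  ultimately show ?thesis using K.hilbert_space by blast
qed

end
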